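(* Let $G=(V,E)$ be a finite simple graph with at least one edge and $k\in\{1,\dots,n\}$. If $c_k$ has an eigenvector of problem (M) with $m$ nodal domains or with $m$ null domains, then $M_m\le\mathrm{vol}(V)\,c_k\le M_k$. In particular $\mathrm{vol}(V)\,c_n=M_n=2\max_{\emptyset\ne S\subsetneq V}|E(S,V\setminus S)|$ and $\mathrm{vol}(V)\,c_2=M_2=2\min_{\emptyset\ne S\subsetneq V}|E(S,V\setminus S)|$.
   Context: $V=\{1,\dots,n\}$, unit edge weights, $|E(A,B)|$ number of edges between $A$ and $B$, $\mathrm{vol}(V)=\sum_i d_i$, $I(\vec x)=\sum_{\{i,j\}\in E}|x_i-x_j|$. $\mathrm{Sgn}(t)=\{1\},[-1,1],\{-1\}$ for $t>0,t=0,t<0$; $(\Delta_1\vec x)_i=\{\sum_{j:\{i,j\}\in E}z_{ij}: z_{ij}\in\mathrm{Sgn}(x_i-x_j),z_{ij}=-z_{ji}\}$. Problem (M): $(\mu,\vec x)$ with $\vec x\ne\vec0$ and $\Delta_1\vec x\cap\mu\,\mathrm{vol}(V)\partial\|\vec x\|_\infty\ne\emptyset$. $c_k=\inf\{\max_{\vec x\in A}\frac{I(\vec x)}{\mathrm{vol}(V)\|\vec x\|_\infty}: A\subseteq\{\|\vec x\|_\infty=1\}\text{ compact}, A=-A,\gamma(A)\ge k\}$, $\gamma$ Krasnoselskii genus. For $\vec x\ne0$, $D_\pm(\vec x)=\{i:\pm x_i=\|\vec x\|_\infty\}$, $D_0(\vec x)=\{i:|x_i|<\|\vec x\|_\infty\}$;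 nodal domains of $\vec x$ are the vertex sets of connected components of the subgraphs induced by $D_+(\vec x)$ and by $D_-(\vec x)$; null domains are those of the subgraph induced by $D_0(\vec x)$. For pairwise disjoint nonempty $V_1,\dots,V_k\subseteq V$ with $V_0=V\setminus(V_1\cup\dots\cup V_k)$, $\mathrm{MC}(V_1,\dots,V_k)=2\max_{S\subseteq\{1,\dots,k\}}\sum_{i\in S,j\notin S}|E(V_i,V_j)|+\sum_{i=1}^k|E(V_i,V_0)|$, and $M_k=\min\mathrm{MC}(V_1,\dots,V_k)$ over all such families. *)

theory Defs
  imports "HOL-Analysis.Analysis" "HOL-Library.Extended_Nat"
begin

(* The vertex set V is the universe of a finite type 'v, so n = CARD('v) and
   vectors indexed by V are elements of real ^ 'v.  The graph is given by its
   set E of edges, each edge being a two-element set of vertices. *)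

section \<open>Finite simple graphs\<close>

definition simple_graph :: "'v::finite set set \<Rightarrow> bool" where
  "simple_graph E \<longleftrightarrow> (\<forall>e\<in>E. card e = 2)"

definition adj :: "'v::finite set set \<Rightarrow> ('v \<times> 'v) set" where
  "adj E = {(i, j). {i, j} \<in> E}"

definition deg :: "'v::finite set set \<Rightarrow> 'v \<Rightarrow> nat" where
  "deg E i = card {j. {i, j} \<in> E}"

definition vol :: "'v::finite set set \<Rightarrow> nat" where
  "vol E = (\<Sum>i\<in>UNIV. deg E i)"

definition edges_between :: "'v::finite set set \<Rightarrow> 'v set \<Rightarrow> 'v set \<Rightarrow> 'v set set" where
  "edges_between E A B = {e \<in> E. \<exists>i\<in>A. \<exists>j\<in>B. e = {i, j}}"

definition components_induced :: "'v::finite set set \<Rightarrow> 'v set \<Rightarrow> 'v set set" where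
  "components_induced E U = U // (adj E \<inter> U \<times> U)\<^sup>*"


section \<open>The 1-Laplacian and problem (M)\<close>

(* adj E contains every edge in both orientations, hence the factor 1/2. *)
definition total_variation :: "'v::finite set set \<Rightarrow> real ^ 'v \<Rightarrow> real" where
  "total_variation E x = (\<Sum>(i, j)\<in>adj E. \<bar>x $ i - x $ j\<bar>) / 2"

definition Sgn :: "real \<Rightarrow> real set" where
  "Sgn t = (if t > 0 then {1} else if t = 0 then {-1..1} else {-1})"

definition one_laplacian :: "'v::finite set set \<Rightarrow> real ^ 'v \<Rightarrow> (real ^ 'v) set" where
  "one_laplacian E x =
    {\<chi> i. \<Sum>j | {i, j} \<in> E. z i j | z.
       \<forall>i j. {i, j} \<in> E \<longrightarrow> z i j \<in> Sgn (x $ i - x $ j) \<and> z i j = - z j i}"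

definition subdifferential :: "('a::real_inner \<Rightarrow> real) \<Rightarrow> 'a \<Rightarrow> 'a set" where
  "subdifferential f x = {u. \<forall>y. f y \<ge> f x + u \<bullet> (y - x)}"

(* infnorm is the library's maximum norm. *)
definition eigenpair_M :: "'v::finite set set \<Rightarrow> real \<Rightarrow> real ^ 'v \<Rightarrow> bool" where
  "eigenpair_M E \<mu> x \<longleftrightarrow>
     x \<noteq> 0 \<and>
     one_laplacian E x \<inter> (\<lambda>u. (\<mu> * real (vol E)) *\<^sub>R u) ` subdifferential infnorm x \<noteq> {}"


section \<open>Krasnoselskii genus and the min-max values\<close>

(* There is an odd continuous map from A to R^k minus the origin; the map is
   given by its coordinates h x 0, ..., h x (k - 1). *)
definition odd_map_to :: "'a::real_normed_vector set \<Rightarrow> nat \<Rightarrow> bool" where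
  "odd_map_to A k \<longleftrightarrow>
     (\<exists>h :: 'a \<Rightarrow> nat \<Rightarrow> real.
        (\<forall>j<k. continuous_on A (\<lambda>x. h x j)) \<and>
        (\<forall>x\<in>A. \<forall>j<k. h (- x) j = - h x j) \<and>
        (\<forall>x\<in>A. \<exists>j<k. h x j \<noteq> 0))"

(* Meant for A = -A.  The genus of the empty set is 0, and the genus is infinite
   if there is no odd continuous map to any R^k minus the origin. *)
definition genus :: "'a::real_normed_vector set \<Rightarrow> enat" where
  "genus A = (INF k\<in>{k. odd_map_to A k}. enat k)"

(* For k \<ge> 1 the sets A are nonempty and compact, so the inner supremum is a
   maximum; for k \<le> n there are such sets A, e.g. the whole unit sphere. *)
definition minmax_value :: "'v::finite set set \<Rightarrow> nat \<Rightarrow> real" where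
  "minmax_value E k =
     (INF A\<in>{A :: (real ^ 'v) set. A \<subseteq> {x. infnorm x = 1} \<and> compact A \<and>
                  A = uminus ` A \<and> genus A \<ge> enat k}.
        SUP x\<in>A. total_variation E x / (real (vol E) * infnorm x))"


section \<open>Nodal domains and null domains\<close>

definition D_plus :: "real ^ 'v::finite \<Rightarrow> 'v set" where
  "D_plus x = {i. x $ i = infnorm x}"

definition D_minus :: "real ^ 'v::finite \<Rightarrow> 'v set" where
  "D_minus x = {i. - (x $ i) = infnorm x}"

definition D_zero :: "real ^ 'v::finite \<Rightarrow> 'v set" where
  "D_zero x = {i. \<bar>x $ i\<bar> < infnorm x}"

definition nodal_domains :: "'v::finite set set \<Rightarrow> real ^ 'v \<Rightarrow> 'v set set" where
  "nodal_domains E x = components_induced E (D_plus x) \<union> components_induced E (D_minus x)"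

definition null_domains :: "'v::finite set set \<Rightarrow> real ^ 'v \<Rightarrow> 'v set set" where
  "null_domains E x = components_induced E (D_zero x)"


section \<open>Multi-way cuts\<close>

definition disjoint_nonempty_family :: "nat \<Rightarrow> (nat \<Rightarrow> 'v set) \<Rightarrow> bool" where
  "disjoint_nonempty_family k W \<longleftrightarrow>
     (\<forall>i\<in>{1..k}. W i \<noteq> {}) \<and> disjoint_family_on W {1..k}"

definition MC :: "'v::finite set set \<Rightarrow> nat \<Rightarrow> (nat \<Rightarrow> 'v set) \<Rightarrow> nat" where
  "MC E k W =
     2 * (MAX S\<in>Pow {1..k}. \<Sum>i\<in>S. \<Sum>j\<in>{1..k} - S. card (edges_between E (W i) (W j)))
     + (\<Sum>i=1..k. card (edges_between E (W i) (UNIV - (\<Union>j\<in>{1..k}. W j))))"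

(* An infimum of natural numbers, hence a minimum whenever there is such a
   family, i.e. for k \<le> n.  For k = 0 the only family is the empty one, with
   value 0. *)
definition multi_cut :: "'v::finite set set \<Rightarrow> nat \<Rightarrow> nat" where
  "multi_cut E k = (INF W\<in>{W. disjoint_nonempty_family k W}. MC E k W)"

end

theory Submission
  imports Defs "HOL-Library.Z2"
begin

text \<open>
  For an eigenvector \<open>x\<close> with subgradient \<open>u\<close> of the maximum norm, summing the eigenvalue equation
  over \<open>D_plus x\<close> and over \<open>D_minus x\<close> cancels all edges inside these sets, and
  \<open>u \<bullet> x = infnorm x\<close> shows that the eigenvalue times the volume is the number of edges leaving
  \<open>D_plus x\<close> plus the number of edges leaving \<open>D_minus x\<close>. Nodal domains of equal sign are not
  adjacent, and neither are different null domains, so their multi-way cuts are at most this number.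

  For the upper bound, the step functions that are constant on each \<open>W i\<close> and vanish elsewhere form
  an odd sphere of genus at least \<open>k\<close> by the Borsuk-Ulam theorem, and the coarea formula bounds the
  total variation on it. Borsuk-Ulam is derived from Ky Fan's parity count for antipodal labellings
  of iterated barycentric subdivisions of the cross-polytope.

  A set of genus \<open>n\<close> is the whole unit sphere and so contains all sign vectors. A set of genus \<open>2\<close>
  contains a vector attaining both \<open>1\<close> and \<open>-1\<close>, all of whose level sets are proper cuts.
\<close>

section \<open>Ky Fan's parity lemma\<close>

text \<open>As simplification rules these rewrite sums over \<open>bit\<close> into bit operations.\<close>

declare add_bit_eq_xor [simp del] mult_bit_eq_and [simp del]

lemma bit_add_self_left [simp]: "a + (a + b) = b" for a b :: bit
  by (cases a; cases b) auto

lemma bit_add_self' [simp]: "a + a = 0" for a :: bit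
  by (cases a) auto

text \<open>Simplices are lists of vertices; a single vertex has the empty simplex as its face.\<close>

fun faces :: "'a list \<Rightarrow> 'a list list" where
  "faces [] = []"
| "faces (v # s) = s # map (Cons v) (faces s)"

lemma faces_map: "faces (map f s) = map (map f) (faces s)"
  by (induction s) (auto simp: comp_def)

lemma length_faces: "t \<in> set (faces s) \<Longrightarrow> Suc (length t) = length s"
  by (induction s arbitrary: t) auto

lemma set_faces: "t \<in> set (faces s) \<Longrightarrow> set t \<subseteq> set s"
  by (induction s arbitrary: t) (auto, blast)

lemma sum_faces_faces:
  fixes \<phi> :: "'a list \<Rightarrow> bit"
  shows "(\<Sum>t\<leftarrow>faces s. \<Sum>r\<leftarrow>faces t. \<phi> r) = 0"
proof (induction s arbitrary: \<phi>)
  case (Cons v s)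
  have "(\<Sum>t\<leftarrow>faces (v # s). \<Sum>r\<leftarrow>faces t. \<phi> r) =
    (\<Sum>r\<leftarrow>faces s. \<phi> r) + ((\<Sum>t\<leftarrow>faces s. \<phi> t) + (\<Sum>t\<leftarrow>faces s. \<Sum>r\<leftarrow>faces t. \<phi> (v # r)))"
    by (simp add: comp_def sum_list_addf)
  also have "\<dots> = 0"
    using Cons.IH[of "\<lambda>r. \<phi> (v # r)"] by (simp add: ac_simps)
  finally show ?case .
qed simp

text \<open>A face drops one entry, and the multiset form makes the count independent of the order
  of the vertices, so that label lists may be sorted by absolute value.\<close>

lemma sum_faces_mset:
  fixes F :: "'a multiset \<Rightarrow> 'b::comm_monoid_add"
  shows "(\<Sum>t\<leftarrow>faces s. F (mset t)) = (\<Sum>x\<in>#mset s. F (mset s - {#x#}))"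
proof (induction s arbitrary: F)
  case (Cons v s)
  have "(\<Sum>t\<leftarrow>faces (v # s). F (mset t)) = F (mset s) + (\<Sum>x\<in>#mset s. F (add_mset v (mset s - {#x#})))"
    using Cons.IH[of "\<lambda>M. F (add_mset v M)"] by (simp add: comp_def)
  also have "(\<Sum>x\<in>#mset s. F (add_mset v (mset s - {#x#}))) = (\<Sum>x\<in>#mset s. F (add_mset v (mset s) - {#x#}))"
    by (intro arg_cong[where f=sum_mset] image_mset_cong) (auto simp: multi_drop_mem_not_eq)
  finally show ?case by simp
qed simp

section \<open>Alternating label sets and their parity\<close>

fun alternating :: "bool \<Rightarrow> int list \<Rightarrow> bool" where
  "alternating b [] = True"
| "alternating b (x # xs) = ((0 < x) = b \<and> alternating (\<not> b) xs)"

text \<open>The indicator, mod 2, of Fan's alternating simplices: ordered by absolute value, the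
  labels change sign at each step, starting positive. A multiset is used because the vertices of a
  simplex come in arbitrary order; the empty simplex counts as alternating.\<close>

definition alt_mset :: "int multiset \<Rightarrow> bit" where
  "alt_mset M = of_bool (\<exists>xs. mset xs = M \<and> sorted_wrt (\<lambda>x y. \<bar>x\<bar> < \<bar>y\<bar>) xs \<and> alternating True xs)"

lemma sorted_wrt_abs_unique:
  fixes xs ys :: "int list"
  assumes "sorted_wrt (\<lambda>x y. \<bar>x\<bar> < \<bar>y\<bar>) xs" "sorted_wrt (\<lambda>x y. \<bar>x\<bar> < \<bar>y\<bar>) ys" "mset xs = mset ys"
  shows "xs = ys"
proof -
  have d: "distinct (map abs zs)" "sorted (map abs zs)" if "sorted_wrt (\<lambda>x y. \<bar>x\<bar> < \<bar>y\<bar>) zs" for zs :: "int list"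
    using that strict_sorted_iff[of "map abs zs"] by (auto simp: sorted_wrt_map)
  have "inj_on abs (set xs)" using d(1)[OF assms(1)] by (simp add: distinct_map)
  then show ?thesis
    by (metis sort_key_inj_key_eq assms d(2))
qed

text \<open>Strictly increasing absolute values leave only one ordering of a multiset, so this list
  alone decides the existential in \<open>alt_mset\<close>.\<close>

lemma alt_mset_sorted:
  assumes "sorted_wrt (\<lambda>x y. \<bar>x\<bar> < \<bar>y\<bar>) xs"
  shows "alt_mset (mset xs) = of_bool (alternating True xs)"
  unfolding alt_mset_def using assms sorted_wrt_abs_unique[OF _ assms]
  by (intro arg_cong[where f=of_bool]) blast

lemma of_bool_alternating_Cons:
  "of_bool (alternating b (x # t)) =
    (if (0 < x) = b then of_bool (alternating (\<not> b) t) else 0 :: bit)"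
  by (cases "(0 < x) = b") (simp_all only: alternating.simps simp_thms of_bool_eq if_True if_False)

text \<open>If the signs of \<open>s\<close> alternate from \<open>b\<close>, only dropping the last
  entry leaves such a list; if they alternate from the opposite sign, only dropping the first. For
  any other list the number of suitable deletions is zero, or two when they repair a single adjacent
  pair of equal signs.\<close>

lemma sum_faces_alternating:
  assumes "s \<noteq> []"
  shows "(\<Sum>t\<leftarrow>faces s. of_bool (alternating b t)) =
    (of_bool (alternating b s) + of_bool (alternating (\<not> b) s) :: bit)"
  using assms
proof (induction s arbitrary: b)
  case (Cons x s)
  show ?case
  proof (cases "s = []")
    case False
    have "(\<Sum>t\<leftarrow>faces (x # s). of_bool (alternating b t)) = (of_bool (alternating b s) +
        (if (0 < x) = b then \<Sum>t\<leftarrow>faces s. of_bool (alternating (\<not> b) t) else 0) :: bit)"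
      by (cases "(0 < x) = b") (simp_all add: comp_def of_bool_alternating_Cons del: alternating.simps)
    also have "\<dots> = of_bool (alternating b (x # s)) + of_bool (alternating (\<not> b) (x # s))"
      unfolding Cons.IH[OF False] of_bool_alternating_Cons
      by (cases "0 < x"; cases b) simp_all
    finally show ?thesis .
  next
    case True
    then show ?thesis by (cases "0 < x"; cases b) simp_all
  qed
qed simp

lemma sorted_wrt_faces: "sorted_wrt P s \<Longrightarrow> t \<in> set (faces s) \<Longrightarrow> sorted_wrt P t"
proof (induction s arbitrary: t)
  case (Cons v s)
  then show ?case using set_faces[of _ s] by fastforce
qed simp

text \<open>\<open>alternating\<close> treats \<open>0\<close> like a negative number, so negation
  reverses all signs only when \<open>0\<close> does not occur.\<close>

lemma alternating_uminus:
  "0 \<notin> set xs \<Longrightarrow> alternating b (map uminus xs) = alternating (\<not> b) xs"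
  by (induction xs arbitrary: b) (simp, simp, linarith?)

lemma alt_mset_duplicate: "alt_mset (add_mset x (add_mset x M)) = 0"
proof -
  have "mset xs \<noteq> add_mset x (add_mset x M)" if "sorted_wrt (\<lambda>x y. \<bar>x\<bar> < \<bar>y\<bar>) xs" for xs :: "int list"
  proof
    assume a: "mset xs = add_mset x (add_mset x M)"
    have "distinct xs"
      using that strict_sorted_iff[of "map abs xs"] by (auto simp: sorted_wrt_map distinct_map)
    then have "count (mset xs) x \<le> 1" by (simp add: distinct_count_atmost_1)
    then show False using a by simp
  qed
  then show ?thesis unfolding alt_mset_def of_bool_eq_0_iff by blast
qed

text \<open>The local count in Ky Fan's argument. For distinct labels it is the sign-list count
  after sorting by absolute value, where negating the labels swaps the starting sign. If a label is
  repeated, the two faces dropping one of two equal labels cancel, and every other face still has a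
  repetition.\<close>

lemma sum_faces_alt_mset:
  assumes "s \<noteq> []" and "\<forall>x\<in>set s. - x \<notin> set s"
  shows "(\<Sum>t\<leftarrow>faces s. alt_mset (mset t)) = alt_mset (mset s) + alt_mset (mset (map uminus s))"
proof (cases "distinct s")
  case True
  have inj: "inj_on abs (set s)"
    using assms(2) by (auto simp: inj_on_def abs_eq_iff)
  define s' where "s' = sort_key abs s"
  have m: "mset s' = mset s" by (simp add: s'_def)
  have "sorted (map abs s')" "distinct (map abs s')"
    using True inj by (simp_all add: s'_def distinct_map)
  then have so: "sorted_wrt (\<lambda>x y. \<bar>x\<bar> < \<bar>y\<bar>) s'"
    using strict_sorted_iff[of "map abs s'"] by (simp add: sorted_wrt_map)
  then have so': "sorted_wrt (\<lambda>x y. \<bar>x\<bar> < \<bar>y\<bar>) (map uminus s')"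
    by (simp add: sorted_wrt_map)
  \<comment> \<open>\<open>0\<close> is excluded as a label because it equals its own
    negative.\<close>
  have s0: "0 \<notin> set s'" "s' \<noteq> []" using assms mset_eq_setD[OF m] by fastforce+
  have "(\<Sum>t\<leftarrow>faces s. alt_mset (mset t)) = (\<Sum>t\<leftarrow>faces s'. alt_mset (mset t))"
    by (simp add: sum_faces_mset m)
  also have "\<dots> = (\<Sum>t\<leftarrow>faces s'. of_bool (alternating True t))"
    by (intro arg_cong[where f=sum_list] map_cong refl alt_mset_sorted sorted_wrt_faces[OF so])
  also have "\<dots> = alt_mset (mset s') + alt_mset (mset (map uminus s'))"
    unfolding sum_faces_alternating[OF s0(2)] alt_mset_sorted[OF so] alt_mset_sorted[OF so'] alternating_uminus[OF s0(1)] ..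
  also have "mset (map uminus s') = mset (map uminus s)" by (simp add: m)
  finally show ?thesis by (simp add: m)
next
  case False
  then obtain M x where M: "mset s = add_mset x (add_mset x M)"
    using not_distinct_decomp[OF False] by fastforce
  have z: "alt_mset (add_mset x (add_mset x M) - {#y#}) = 0" if "y \<in># M" for y
  proof -
    have "add_mset x (add_mset x M) - {#y#} = add_mset x (add_mset x (M - {#y#}))"
      using that by (simp add: add_mset_remove_trivial_If)
    then show ?thesis by (simp add: alt_mset_duplicate)
  qed
  have "(\<Sum>t\<leftarrow>faces s. alt_mset (mset t)) = alt_mset (add_mset x M) + (alt_mset (add_mset x M) + (\<Sum>y\<in>#M. alt_mset (add_mset x (add_mset x M) - {#y#})))"
    by (simp add: sum_faces_mset M)
  also have "(\<Sum>y\<in>#M. alt_mset (add_mset x (add_mset x M) - {#y#})) = (\<Sum>y\<in>#M. 0)"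
    by (intro arg_cong[where f=sum_mset] image_mset_cong z)
  also have "alt_mset (add_mset x M) + (alt_mset (add_mset x M) + (\<Sum>y\<in>#M. 0)) = 0" by (simp add: ac_simps)
  finally show ?thesis by (simp add: M alt_mset_duplicate)
qed

section \<open>Barycentric subdivision of a simplex and its mesh\<close>

lemma sum_list_map_concat:
  fixes f :: "'a \<Rightarrow> 'b::comm_monoid_add"
  shows "(\<Sum>x\<leftarrow>concat xss. f x) = (\<Sum>xs\<leftarrow>xss. \<Sum>x\<leftarrow>xs. f x)"
  by (induction xss) auto

definition barycenter :: "'a::real_vector list \<Rightarrow> 'a" where
  "barycenter s = sum_list s /\<^sub>R real (length s)"

lemma barycenter_uminus: "barycenter (map uminus s) = - barycenter s"
  using uminus_sum_list_map[of "\<lambda>x. x" s]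
  by (simp add: barycenter_def comp_def flip: scaleR_minus_right)

text \<open>Top simplices of the subdivision correspond to full flags of faces: the barycenter of
  \<open>s\<close> is coned with the subdivisions of its faces, down to the empty simplex.\<close>

function sd :: "'a::real_vector list \<Rightarrow> 'a list list" where
  "sd s = (if s = [] then [[]] else map (Cons (barycenter s)) (concat (map sd (faces s))))"
  by auto
termination by (relation "Wellfounded.measure length") (auto dest: length_faces)

declare sd.simps [simp del]

lemma sd_Nil: "sd [] = [[]]"
  by (simp add: sd.simps)

lemma sd_nonempty: "s \<noteq> [] \<Longrightarrow> sd s = map (Cons (barycenter s)) (concat (map sd (faces s)))"
  by (subst sd.simps) simp

lemma sd_uminus: "sd (map uminus s) = map (map uminus) (sd s)"
proof (induction s rule: sd.induct)
  case (1 s)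
  show ?case
  proof (cases "s = []")
    case False
    then show ?thesis
      using 1 by (simp add: sd_nonempty faces_map barycenter_uminus map_concat comp_def cong: map_cong)
  qed (simp add: sd_Nil)
qed

text \<open>Subdivision is a chain map mod 2. Faces omitting the barycenter of \<open>s\<close> form
  the subdivided boundary; the others are cones over the boundary of the subdivided boundary, which
  by induction is the subdivided boundary of the boundary and vanishes.\<close>

lemma sum_sd_faces:
  fixes \<phi> :: "'a::real_vector list \<Rightarrow> bit"
  shows "(\<Sum>t\<leftarrow>sd s. \<Sum>r\<leftarrow>faces t. \<phi> r) = (\<Sum>t\<leftarrow>faces s. \<Sum>r\<leftarrow>sd t. \<phi> r)"
proof (induction s arbitrary: \<phi> rule: sd.induct)
  case (1 s)
  show ?case
  proof (cases "s = []")
    case False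
    define \<psi> where "\<psi> r = \<phi> (barycenter s # r)" for r
    have "(\<Sum>t\<leftarrow>sd s. \<Sum>r\<leftarrow>faces t. \<phi> r) =
      (\<Sum>t\<leftarrow>faces s. \<Sum>r\<leftarrow>sd t. \<phi> r) + (\<Sum>t\<leftarrow>faces s. \<Sum>r\<leftarrow>sd t. \<Sum>q\<leftarrow>faces r. \<psi> q)"
      using False by (simp add: sd_nonempty sum_list_map_concat comp_def sum_list_addf \<psi>_def)
    also have "(\<Sum>t\<leftarrow>faces s. \<Sum>r\<leftarrow>sd t. \<Sum>q\<leftarrow>faces r. \<psi> q) =
      (\<Sum>t\<leftarrow>faces s. \<Sum>q\<leftarrow>faces t. \<Sum>r\<leftarrow>sd q. \<psi> r)"
      by (intro arg_cong[where f=sum_list] map_cong refl 1[OF False])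
    also have "\<dots> = 0" by (rule sum_faces_faces)
    finally show ?thesis by simp
  qed (simp add: sd_Nil)
qed

lemma length_sd: "t \<in> set (sd s) \<Longrightarrow> length t = length s"
proof (induction s arbitrary: t rule: sd.induct)
  case (1 s)
  show ?case
  proof (cases "s = []")
    case False
    then show ?thesis using 1 by (fastforce simp: sd_nonempty dest: length_faces)
  qed (use 1 in \<open>simp add: sd_Nil\<close>)
qed

lemma barycenter_in_hull:
  assumes "s \<noteq> []"
  shows "barycenter s \<in> convex hull set s"
proof -
  have "sum_list s = (\<Sum>i<length s. s ! i)"
    by (simp add: sum_list_sum_nth atLeast0LessThan)
  then have "barycenter s = (\<Sum>i<length s. (1 / real (length s)) *\<^sub>R s ! i)"
    by (simp add: barycenter_def scaleR_sum_right inverse_eq_divide)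
  also have "\<dots> \<in> convex hull set s"
    using assms by (intro convex_sum) (auto intro: hull_inc)
  finally show ?thesis .
qed

lemma sd_subset_hull: "t \<in> set (sd s) \<Longrightarrow> set t \<subseteq> convex hull set s"
proof (induction s arbitrary: t rule: sd.induct)
  case (1 s)
  show ?case
  proof (cases "s = []")
    case False
    then obtain f r where t: "t = barycenter s # r" "f \<in> set (faces s)" "r \<in> set (sd f)"
      using 1(2) by (auto simp: sd_nonempty)
    then have "set r \<subseteq> convex hull set s"
      using 1(1)[OF False, of f r] hull_mono[OF set_faces[OF t(2)], of convex] by auto
    then show ?thesis using t(1) barycenter_in_hull[OF False] by simp
  qed (use 1 in \<open>simp add: sd_Nil\<close>)
qed

text \<open>Among the differences between a vertex \<open>v\<close> and all vertices, one is zero,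
  which saves the factor in their average; the bound passes from the vertices to the hull because
  balls are convex.\<close>

lemma dist_barycenter:
  fixes s :: "'a::real_normed_vector list"
  assumes D: "\<And>u v. u \<in> set s \<Longrightarrow> v \<in> set s \<Longrightarrow> dist u v \<le> D" and x: "x \<in> convex hull set s"
  shows "dist (barycenter s) x \<le> (1 - 1 / real (length s)) * D"
proof -
  have ne: "s \<noteq> []" using x by auto
  have v: "dist (barycenter s) v \<le> (1 - 1 / real (length s)) * D" if "v \<in> set s" for v
  proof -
    have "sum_list s - real (length s) *\<^sub>R v = (\<Sum>u\<leftarrow>s. u - v)"
      by (induction s) (auto simp: algebra_simps)
    then have "real (length s) *\<^sub>R (barycenter s - v) = (\<Sum>u\<leftarrow>s. u - v)"
      using ne by (simp add: barycenter_def scaleR_diff_right)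
    then have "real (length s) * norm (barycenter s - v) = norm (\<Sum>u\<leftarrow>s. u - v)"
      by (metis norm_scaleR abs_of_nat)
    also have "\<dots> \<le> (\<Sum>u\<leftarrow>s. norm (u - v))"
      by (induction s) (auto intro: norm_triangle_le)
    also have "\<dots> = (\<Sum>u\<leftarrow>remove1 v s. norm (u - v))"
      using that by (simp add: sum_list_map_remove1)
    also have "\<dots> \<le> (\<Sum>u\<leftarrow>remove1 v s. D)"
      using D that by (intro sum_list_mono) (auto simp: dist_norm dest: notin_set_remove1)
    also have "\<dots> = (real (length s) - 1) * D"
      using that ne by (simp add: sum_list_triv length_remove1 of_nat_diff Suc_leI)
    finally show ?thesis
      using ne by (simp add: dist_norm field_simps)
  qed
  have "convex hull set s \<subseteq> cball (barycenter s) ((1 - 1 / real (length s)) * D)"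
    using v by (intro hull_minimal) auto
  then show ?thesis using x by auto
qed

text \<open>Two vertices of a subdivided simplex either include the barycenter or both come from the
  subdivision of a face. The bound \<open>K\<close> on the length gives one contraction factor for
  all dimensions, as the induction over faces requires.\<close>

lemma mesh_sd:
  fixes s :: "'a::real_normed_vector list"
  assumes "\<And>u v. u \<in> set s \<Longrightarrow> v \<in> set s \<Longrightarrow> dist u v \<le> D"
    and "length s \<le> K" "0 \<le> D" "t \<in> set (sd s)" "u \<in> set t" "v \<in> set t"
  shows "dist u v \<le> (1 - 1 / real K) * D"
  using assms
proof (induction s arbitrary: t u v rule: sd.induct)
  case (1 s)
  show ?case
  proof (cases "s = []")
    case False
    then obtain f r where t: "t = barycenter s # r" "f \<in> set (faces s)" "r \<in> set (sd f)"
      using 1 by (auto simp: sd_nonempty)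
    have "length s \<ge> 1" using False by (simp add: Suc_leI)
    then have "1 - 1 / real (length s) \<le> 1 - 1 / real K"
      using 1(3) False frac_le[of 1 1 "real (length s)" "real K"] by simp
    then have le: "(1 - 1 / real (length s)) * D \<le> (1 - 1 / real K) * D"
      using 1(4) by (rule mult_right_mono)
    have b: "dist (barycenter s) w \<le> (1 - 1 / real K) * D" if "w \<in> set r" for w
    proof -
      have "w \<in> convex hull set s"
        using that sd_subset_hull[OF t(3)] hull_mono[OF set_faces[OF t(2)], of convex] by auto
      from dist_barycenter[OF 1(2) this] le show ?thesis by auto
    qed
    have r: "dist u v \<le> (1 - 1 / real K) * D" if "u \<in> set r" "v \<in> set r" for u v
    proof (rule 1(1)[OF False t(2) _ _ 1(4) t(3) that])
      show "dist u v \<le> D" if "u \<in> set f" "v \<in> set f" for u v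
        using 1(2) that set_faces[OF t(2)] by blast
      show "length f \<le> K" using 1(3) length_faces[OF t(2)] by simp
    qed
    have "0 \<le> (1 - 1 / real K) * D"
      using 1(3,4) \<open>length s \<ge> 1\<close> by (intro mult_nonneg_nonneg) (auto simp: field_simps)
    then show ?thesis using 1(6,7) b r t(1) by (auto simp: dist_commute)
  qed (use 1 in \<open>simp add: sd_Nil\<close>)
qed

section \<open>Iterated subdivisions, hemispheres and the parity count\<close>

primrec sds :: "nat \<Rightarrow> 'a::real_vector list list \<Rightarrow> 'a list list" where
  "sds 0 L = L"
| "sds (Suc n) L = concat (map sd (sds n L))"

lemma sum_sds:
  fixes \<phi> :: "'a::real_vector list \<Rightarrow> bit"
  shows "(\<Sum>t\<leftarrow>sds n L. \<phi> t) = (\<Sum>s\<leftarrow>L. \<Sum>t\<leftarrow>sds n [s]. \<phi> t)"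
  by (induction n arbitrary: \<phi>) (simp_all add: sum_list_map_concat)

lemma sds_uminus: "sds n (map (map uminus) L) = map (map uminus) (sds n L)"
  by (induction n) (simp_all add: map_concat sd_uminus comp_def)

lemma sds_single_uminus: "sds n [map uminus s] = map (map uminus) (sds n [s])"
  using sds_uminus[of n "[s]"] by simp

text \<open>The chain map property, iterated: mod 2, boundary and \<open>n\<close>-fold subdivision
  commute.\<close>

lemma sum_sds_faces:
  fixes \<phi> :: "'a::real_vector list \<Rightarrow> bit"
  shows "(\<Sum>t\<leftarrow>sds n L. \<Sum>r\<leftarrow>faces t. \<phi> r) = (\<Sum>s\<leftarrow>L. \<Sum>r\<leftarrow>faces s. \<Sum>t\<leftarrow>sds n [r]. \<phi> t)"
proof (induction n arbitrary: \<phi>)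
  case (Suc n)
  show ?case using Suc.IH[of "\<lambda>t. \<Sum>r\<leftarrow>sd t. \<phi> r"] by (simp add: sum_list_map_concat sum_sd_faces comp_def)
qed simp

text \<open>A hemisphere of the boundary of the cross-polytope with vertices \<open>\<plusminus>e 0, \<dots>, \<plusminus>e k\<close>.\<close>

primrec hemi :: "(nat \<Rightarrow> 'a::real_vector) \<Rightarrow> nat \<Rightarrow> 'a list list" where
  "hemi e 0 = [[e 0]]"
| "hemi e (Suc k) = map (Cons (e (Suc k))) (hemi e k @ map (map uminus) (hemi e k))"

text \<open>Mod 2 the boundary of a hemisphere is the equator, made of the hemisphere one dimension
  down and its antipode: the sides of the cones cancel because the equator has no boundary.\<close>

lemma sum_faces_hemi:
  fixes \<phi> :: "'a::real_vector list \<Rightarrow> bit"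
  shows "(\<Sum>t\<leftarrow>hemi e (Suc k). \<Sum>r\<leftarrow>faces t. \<phi> r) =
    (\<Sum>t\<leftarrow>hemi e k. \<phi> t) + (\<Sum>t\<leftarrow>hemi e k. \<phi> (map uminus t))"
proof (induction k arbitrary: \<phi>)
  case 0
  show ?case by (simp add: ac_simps)
next
  case (Suc k)
  define \<psi> where "\<psi> r = \<phi> (e (Suc (Suc k)) # r)" for r
  \<comment> \<open>The two halves of the equator have the same boundary, because by
    \<open>Suc.IH\<close> that boundary is invariant under negation.\<close>
  have c: "(\<Sum>t\<leftarrow>hemi e (Suc k). \<Sum>r\<leftarrow>faces t. \<psi> r) +
      (\<Sum>t\<leftarrow>hemi e (Suc k). \<Sum>r\<leftarrow>faces t. \<psi> (map uminus r)) = 0"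
    unfolding Suc.IH by (simp add: comp_def ac_simps del: hemi.simps)
  have "(\<Sum>t\<leftarrow>hemi e (Suc (Suc k)). \<Sum>r\<leftarrow>faces t. \<phi> r) =
    (\<Sum>t\<leftarrow>hemi e (Suc k). \<phi> t) + (\<Sum>t\<leftarrow>hemi e (Suc k). \<phi> (map uminus t)) +
    ((\<Sum>t\<leftarrow>hemi e (Suc k). \<Sum>r\<leftarrow>faces t. \<psi> r) +
     (\<Sum>t\<leftarrow>hemi e (Suc k). \<Sum>r\<leftarrow>faces t. \<psi> (map uminus r)))"
    unfolding hemi.simps(2)[of e "Suc k"]
    by (simp add: comp_def sum_list_addf \<psi>_def faces_map ac_simps del: hemi.simps)
  then show ?case unfolding c by simp
qed

lemma sds_single: "sds n [[v]] = [[v]]"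
  by (induction n) (simp_all add: sd_nonempty sd_Nil barycenter_def)

text \<open>The number of alternating simplices, counted together with their antipodes, is odd on
  each subdivided hemisphere. Summing the local face count leaves only the faces on the equator,
  whose two halves reproduce the count one dimension down. This induction is why the hypotheses
  range over all \<open>j \<le> k\<close>.\<close>

lemma ky_fan:
  fixes e :: "nat \<Rightarrow> 'a::real_vector" and l :: "'a \<Rightarrow> int"
  assumes odd: "\<And>j t v. j \<le> k \<Longrightarrow> t \<in> set (sds n (hemi e j)) \<Longrightarrow> v \<in> set t \<Longrightarrow> l (- v) = - l v"
    and compl: "\<And>j t u v. j \<le> k \<Longrightarrow> t \<in> set (sds n (hemi e j)) \<Longrightarrow> u \<in> set t \<Longrightarrow> v \<in> set t \<Longrightarrow> l u \<noteq> - l v"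
    and len: "\<And>j t. j \<le> k \<Longrightarrow> t \<in> set (sds n (hemi e j)) \<Longrightarrow> t \<noteq> []"
  shows "\<exists>t\<in>set (sds n (hemi e k)). distinct (map (\<lambda>v. \<bar>l v\<bar>) t)"
proof -
  define a where "a t = alt_mset (mset (map l t))" for t
  have f: "(\<Sum>r\<leftarrow>faces t. a r) = a t + a (map uminus t)" if "j \<le> k" "t \<in> set (sds n (hemi e j))" for j t
  proof -
    have "(\<Sum>r\<leftarrow>faces t. a r) = (\<Sum>r\<leftarrow>faces (map l t). alt_mset (mset r))"
      by (simp add: faces_map a_def comp_def)
    also have "\<dots> = alt_mset (mset (map l t)) + alt_mset (mset (map uminus (map l t)))"
      using len[OF that] compl[OF that] by (intro sum_faces_alt_mset) force+
    also have "map uminus (map l t) = map l (map uminus t)"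
      using odd[OF that] by simp
    finally show ?thesis by (simp add: a_def del: mset_map map_map)
  qed
  have "(\<Sum>t\<leftarrow>sds n (hemi e j). a t + a (map uminus t)) = 1" if "j \<le> k" for j
    using that
  proof (induction j)
    case 0
    have "(\<Sum>t\<leftarrow>sds n (hemi e 0). a t + a (map uminus t)) = (\<Sum>t\<leftarrow>sds n (hemi e 0). \<Sum>r\<leftarrow>faces t. a r)"
      using f[OF 0] by (intro arg_cong[where f=sum_list] map_cong) auto
    \<comment> \<open>In dimension 0 the only face is the empty simplex, which is
      alternating.\<close>
    also have "\<dots> = alt_mset (mset [])"
      by (simp add: sds_single a_def)
    also have "\<dots> = 1" by (subst alt_mset_sorted) auto
    finally show ?case .
  next
    case (Suc j)
    have "(\<Sum>t\<leftarrow>sds n (hemi e (Suc j)). a t + a (map uminus t)) =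
        (\<Sum>t\<leftarrow>sds n (hemi e (Suc j)). \<Sum>r\<leftarrow>faces t. a r)"
      using f[OF Suc.prems] by (intro arg_cong[where f=sum_list] map_cong) auto
    also have "\<dots> = (\<Sum>s\<leftarrow>hemi e j. \<Sum>t\<leftarrow>sds n [s]. a t) + (\<Sum>s\<leftarrow>hemi e j. \<Sum>t\<leftarrow>sds n [map uminus s]. a t)"
      by (simp only: sum_sds_faces sum_faces_hemi)
    also have "(\<Sum>s\<leftarrow>hemi e j. \<Sum>t\<leftarrow>sds n [map uminus s]. a t) = (\<Sum>s\<leftarrow>hemi e j. \<Sum>t\<leftarrow>sds n [s]. a (map uminus t))"
      by (simp add: sds_single_uminus comp_def)
    also have "(\<Sum>s\<leftarrow>hemi e j. \<Sum>t\<leftarrow>sds n [s]. a t) + \<dots> = (\<Sum>t\<leftarrow>sds n (hemi e j). a t + a (map uminus t))"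
      unfolding sum_list_addf by (simp only: sum_sds[symmetric])
    also have "\<dots> = 1" using Suc by simp
    finally show ?case .
  qed
  from this[of k] have "(\<Sum>t\<leftarrow>sds n (hemi e k). a t + a (map uminus t)) \<noteq> 0" by simp
  moreover have "(\<Sum>t\<leftarrow>sds n (hemi e k). a t + a (map uminus t)) = 0"
    if "\<And>t. t \<in> set (sds n (hemi e k)) \<Longrightarrow> a t + a (map uminus t) = 0"
  proof -
    have "(\<Sum>t\<leftarrow>sds n (hemi e k). a t + a (map uminus t)) = (\<Sum>t\<leftarrow>sds n (hemi e k). 0)"
      by (intro arg_cong[where f=sum_list] map_cong refl that)
    then show ?thesis by simp
  qed
  ultimately obtain t where t: "t \<in> set (sds n (hemi e k))" "a t + a (map uminus t) \<noteq> 0"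
    by blast
  \<comment> \<open>A nonzero \<open>a\<close> forces an ordering with strictly increasing absolute
    values; passing to the antipodal simplex does not change these values.\<close>
  have alt: "distinct (map (\<lambda>v. \<bar>l v\<bar>) xs)" if "a xs \<noteq> 0" for xs
  proof -
    have "\<exists>ys. mset ys = mset (map l xs) \<and> sorted_wrt (\<lambda>x y. \<bar>x\<bar> < \<bar>y\<bar>) ys"
      using that unfolding a_def alt_mset_def of_bool_eq_0_iff by blast
    then obtain ys where ys: "mset ys = mset (map l xs)" "sorted_wrt (\<lambda>x y. \<bar>x\<bar> < \<bar>y\<bar>) ys"
      by blast
    then have "distinct (map abs ys)"
      using strict_sorted_iff[of "map abs ys"] by (simp add: sorted_wrt_map)
    moreover have "mset (map abs ys) = mset (map abs (map l xs))"
      unfolding mset_map[of abs] ys(1) ..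
    ultimately have "distinct (map abs (map l xs))"
      using mset_eq_imp_distinct_iff by blast
    then show ?thesis by (simp add: comp_def)
  qed
  have "map (\<lambda>v. \<bar>l v\<bar>) (map uminus t) = map (\<lambda>v. \<bar>l v\<bar>) t"
    using odd[OF _ t(1)] by simp
  moreover have "a t \<noteq> 0 \<or> a (map uminus t) \<noteq> 0" using t(2) by auto
  ultimately have "distinct (map (\<lambda>v. \<bar>l v\<bar>) t)"
    using alt[of t] alt[of "map uminus t"] by argo
  then show ?thesis using t(1) by blast
qed

section \<open>The Borsuk-Ulam theorem for the cross-polytope\<close>

lemma length_hemi: "t \<in> set (hemi e k) \<Longrightarrow> length t = Suc k"
  by (induction k arbitrary: t) auto

definition octant :: "(nat \<Rightarrow> 'a::real_vector) \<Rightarrow> nat \<Rightarrow> nat set \<Rightarrow> 'a set" where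
  "octant e k S = convex hull ((\<lambda>i. if i \<in> S then e i else - e i) ` {..k})"

text \<open>For linearly independent \<open>e i\<close>, the boundary of the cross-polytope with
  vertices \<open>e i\<close> and \<open>- e i\<close>, as the union of its facets; \<open>S\<close>
  selects the positive signs.\<close>

definition cross_sphere :: "(nat \<Rightarrow> 'a::real_vector) \<Rightarrow> nat \<Rightarrow> 'a set" where
  "cross_sphere e k = (\<Union>S. octant e k S)"

lemma cross_sphere_finite: "cross_sphere e k = (\<Union>S\<in>Pow {..k}. octant e k S)"
proof -
  have "octant e k S = octant e k (S \<inter> {..k})" for S
    unfolding octant_def by (intro arg_cong[where f="\<lambda>A. convex hull A"] image_cong) auto
  then show ?thesis unfolding cross_sphere_def by blast
qed

lemma compact_cross_sphere: "compact (cross_sphere e k)" for e :: "nat \<Rightarrow> 'a::real_normed_vector"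
  unfolding cross_sphere_finite octant_def
  by (intro compact_UN finite_Pow_iff[THEN iffD2] finite_imp_compact_convex_hull) auto

text \<open>The vertices of a simplex of the hemisphere belong to one facet; the antipodal copies in
  the recursion switch to the complementary sign set.\<close>

lemma set_hemi:
  "t \<in> set (hemi e k) \<Longrightarrow> \<exists>S. set t \<subseteq> (\<lambda>i. if i \<in> S then e i else - e i) ` {..k}"
proof (induction k arbitrary: t)
  case 0
  then show ?case by (auto intro!: exI[of _ "{0}"])
next
  case (Suc k)
  define g where "g S i = (if i \<in> S then e i else - e i)" for S i
  have IH: "\<exists>S. set r \<subseteq> g S ` {..k}" if "r \<in> set (hemi e k)" for r
    using Suc.IH[OF that] by (simp add: g_def)
  obtain r where r: "r \<in> set (hemi e k)" "t = e (Suc k) # r \<or> t = e (Suc k) # map uminus r"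
    using Suc.prems by auto
  then obtain S where S: "set r \<subseteq> g S ` {..k}" using IH by blast
  moreover have "uminus ` g S ` {..k} = g (- S) ` {..k}"
    unfolding image_image by (intro image_cong) (auto simp: g_def)
  ultimately have "set (map uminus r) \<subseteq> g (- S) ` {..k}"
    unfolding set_map by blast
  then have "\<exists>S. set t \<subseteq> insert (e (Suc k)) (g S ` {..k})"
    using r(2) S by fastforce
  then obtain S where S: "set t \<subseteq> insert (e (Suc k)) (g S ` {..k})" by blast
  \<comment> \<open>\<open>S\<close> matters only on \<open>{..k}\<close>, so \<open>Suc k\<close>
    can be added to give the new vertex a positive sign.\<close>
  have "g S ` {..k} = g (insert (Suc k) S) ` {..k}"
    by (intro image_cong) (auto simp: g_def)
  moreover have "e (Suc k) = g (insert (Suc k) S) (Suc k)" by (simp add: g_def)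
  ultimately have "insert (e (Suc k)) (g S ` {..k}) = g (insert (Suc k) S) ` {..Suc k}"
    unfolding atMost_Suc image_insert by (rule arg_cong2[of _ _ _ _ insert, rotated])
  with S have "set t \<subseteq> g (insert (Suc k) S) ` {..Suc k}" by (rule subset_trans[OF _ equalityD1])
  then show ?case unfolding g_def by (rule exI)
qed

text \<open>Subdividing never leaves a facet, since facets are convex, and the mesh shrinks
  geometrically, with the same factor for all \<open>j \<le> k\<close>.\<close>

lemma sds_hemi:
  fixes e :: "nat \<Rightarrow> 'a::real_normed_vector"
  assumes "t \<in> set (sds n (hemi e j))" "j \<le> k"
    and D: "\<And>x y. x \<in> cross_sphere e k \<Longrightarrow> y \<in> cross_sphere e k \<Longrightarrow> dist x y \<le> D"
  shows "length t = Suc j \<and> (\<exists>S. set t \<subseteq> octant e k S) \<and>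
    (\<forall>u\<in>set t. \<forall>v\<in>set t. dist u v \<le> (1 - 1 / real (Suc k)) ^ n * D)"
  using assms(1)
proof (induction n arbitrary: t)
  case 0
  have t: "t \<in> set (hemi e j)" using 0 by simp
  obtain S where "set t \<subseteq> (\<lambda>i. if i \<in> S then e i else - e i) ` {..j}"
    using set_hemi[OF t] by blast
  also have "\<dots> \<subseteq> (\<lambda>i. if i \<in> S then e i else - e i) ` {..k}" using assms(2) by auto
  also have "\<dots> \<subseteq> octant e k S" unfolding octant_def by (rule hull_subset)
  finally have S: "set t \<subseteq> octant e k S" .
  moreover have "set t \<subseteq> cross_sphere e k" using S unfolding cross_sphere_def by blast
  then have "dist u v \<le> D" if "u \<in> set t" "v \<in> set t" for u v
    using D that by blast
  ultimately show ?case using length_hemi[OF t] by auto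
next
  case (Suc n)
  then obtain s where s: "s \<in> set (sds n (hemi e j))" "t \<in> set (sd s)" by auto
  from Suc.IH[OF s(1)] obtain S where S: "length s = Suc j" "set s \<subseteq> octant e k S"
    "\<And>u v. u \<in> set s \<Longrightarrow> v \<in> set s \<Longrightarrow> dist u v \<le> (1 - 1 / real (Suc k)) ^ n * D" by blast
  have "set t \<subseteq> convex hull set s" using sd_subset_hull s(2) by blast
  also have "\<dots> \<subseteq> octant e k S" using S(2) by (intro hull_minimal) (auto simp: octant_def)
  finally have "set t \<subseteq> octant e k S" .
  \<comment> \<open>The bound is nonnegative because it dominates the distance of a vertex to
    itself.\<close>
  moreover have "0 \<le> (1 - 1 / real (Suc k)) ^ n * D"
    using S(1) S(3)[of "hd s" "hd s"] by (cases s) auto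
  then have "dist u v \<le> (1 - 1 / real (Suc k)) ^ Suc n * D" if "u \<in> set t" "v \<in> set t" for u v
    using mesh_sd[OF S(3) _ _ s(2) that, of "Suc k"] S(1) assms(2) unfolding power_Suc mult.assoc by simp
  ultimately show ?case using length_sd[OF s(2)] S(1) by auto
qed

text \<open>Given an odd map \<open>h\<close> without zeros, each point is labelled by the sign and
  index of a coordinate where \<open>h\<close> has absolute value at least \<open>\<delta>\<close>.
  On a fine subdivision no simplex has opposite labels, so Ky Fan's lemma yields
  \<open>k + 1\<close> labels with distinct absolute values among \<open>m\<close> possible
  ones.\<close>

lemma borsuk_ulam_cross_sphere:
  fixes e :: "nat \<Rightarrow> 'a::real_normed_vector"
  assumes "odd_map_to (cross_sphere e k) m"
  shows "k < m"
proof -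
  define Q where "Q = cross_sphere e k"
  obtain h :: "'a \<Rightarrow> nat \<Rightarrow> real" where cont: "\<And>j. j < m \<Longrightarrow> continuous_on Q (\<lambda>x. h x j)"
    and odd: "\<And>x j. x \<in> Q \<Longrightarrow> j < m \<Longrightarrow> h (- x) j = - h x j"
    and nz: "\<And>x. x \<in> Q \<Longrightarrow> \<exists>j<m. h x j \<noteq> 0"
    using assms unfolding odd_map_to_def Q_def by blast
  have Q: "compact Q" unfolding Q_def by (rule compact_cross_sphere)
  have "e 0 \<in> octant e k UNIV" unfolding octant_def by (auto intro!: hull_inc)
  then have ne: "Q \<noteq> {}" unfolding Q_def cross_sphere_def by blast
  then have m: "m > 0" using nz by fastforce
  have "continuous_on Q (\<lambda>x. \<Sum>j<m. \<bar>h x j\<bar>)"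
    using cont by (intro continuous_intros) auto
  then obtain x0 where x0: "x0 \<in> Q" "\<And>x. x \<in> Q \<Longrightarrow> (\<Sum>j<m. \<bar>h x0 j\<bar>) \<le> (\<Sum>j<m. \<bar>h x j\<bar>)"
    using continuous_attains_inf[OF Q ne] by blast
  \<comment> \<open>The average absolute coordinate at the point minimising the sum of absolute
    coordinates; everywhere on \<open>Q\<close> the largest coordinate is at least this
    average.\<close>
  define \<delta> where "\<delta> = (\<Sum>j<m. \<bar>h x0 j\<bar>) / real m"
  obtain j0 where "j0 < m" "h x0 j0 \<noteq> 0" using nz x0(1) by blast
  then have "(\<Sum>j<m. \<bar>h x0 j\<bar>) > 0"
    by (intro sum_pos2[of _ j0]) auto
  then have \<delta>: "\<delta> > 0" using m by (simp add: \<delta>_def)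
  have big: "\<exists>j<m. \<bar>h x j\<bar> \<ge> \<delta>" if "x \<in> Q" for x
  proof (rule ccontr)
    assume "\<not> ?thesis"
    then have "(\<Sum>j<m. \<bar>h x j\<bar>) < (\<Sum>j<m. \<delta>)" using m by (intro sum_strict_mono) auto
    then show False using x0(2)[OF that] m by (simp add: \<delta>_def)
  qed
  define J where "J x = (LEAST j. j < m \<and> \<bar>h x j\<bar> \<ge> \<delta>)" for x
  have J: "J x < m" "\<bar>h x (J x)\<bar> \<ge> \<delta>" if "x \<in> Q" for x
    using LeastI_ex[OF big[OF that]] unfolding J_def by auto
  have J_uminus: "J (- x) = J x" if "x \<in> Q" for x
  proof -
    have "(j < m \<and> \<bar>h (- x) j\<bar> \<ge> \<delta>) = (j < m \<and> \<bar>h x j\<bar> \<ge> \<delta>)" for j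
      using odd[OF that, of j] by auto
    then show ?thesis unfolding J_def by simp
  qed
  \<comment> \<open>The index is shifted by one so that no label is \<open>0\<close> and its sign is
    determined.\<close>
  define l where "l x = (if h x (J x) > 0 then int (Suc (J x)) else - int (Suc (J x)))" for x
  have l_uminus: "l (- x) = - l x" if "x \<in> Q" for x
    using odd[OF that J(1)[OF that]] J(2)[OF that] \<delta> by (auto simp: l_def J_uminus[OF that])
  have "\<exists>d>0. \<forall>x\<in>Q. \<forall>y\<in>Q. dist x y < d \<longrightarrow> dist (h x j) (h y j) < \<delta>" if "j < m" for j
    using compact_uniformly_continuous[OF cont[OF that] Q] \<delta> unfolding uniformly_continuous_on_def
    by (auto simp: dist_commute)
  then have "\<forall>j. \<exists>d. j < m \<longrightarrow> d > 0 \<and> (\<forall>x\<in>Q. \<forall>y\<in>Q. dist x y < d \<longrightarrow> dist (h x j) (h y j) < \<delta>)"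
    by blast
  then obtain d where d: "\<And>j. j < m \<Longrightarrow> d j > 0"
    "\<And>j x y. j < m \<Longrightarrow> x \<in> Q \<Longrightarrow> y \<in> Q \<Longrightarrow> dist x y < d j \<Longrightarrow> dist (h x j) (h y j) < \<delta>"
    unfolding choice_iff by blast
  define \<eta> where "\<eta> = Min (d ` {..<m})"
  have \<eta>: "\<eta> > 0" "\<And>j. j < m \<Longrightarrow> \<eta> \<le> d j"
    using d(1) m by (simp_all add: \<eta>_def Min_gr_iff lessThan_empty_iff)
  \<comment> \<open>Opposite labels mean that one coordinate of \<open>h\<close> is at least
    \<open>\<delta>\<close> in size with opposite signs at \<open>x\<close> and \<open>y\<close>, a
    gap excluded by uniform continuity at distance below \<open>\<eta>\<close>.\<close>
  have compl: "l x \<noteq> - l y" if "x \<in> Q" "y \<in> Q" "dist x y < \<eta>" for x y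
  proof
    assume a: "l x = - l y"
    then have "J x = J y" "(h x (J x) > 0) \<noteq> (h y (J y) > 0)" by (auto simp: l_def split: if_splits)
    moreover have "dist (h x (J x)) (h y (J x)) < \<delta>"
      using d(2)[OF J(1)[OF that(1)] that(1,2)] \<eta>(2)[OF J(1)[OF that(1)]] that(3) by simp
    ultimately show False using J(2)[OF that(1)] J(2)[OF that(2)] by (auto simp: dist_real_def split: if_splits)
  qed
  define D where "D = diameter Q"
  have D: "dist x y \<le> D" if "x \<in> Q" "y \<in> Q" for x y
    using diameter_bounded_bound[OF compact_imp_bounded[OF Q] that] by (simp add: D_def)
  have "(\<lambda>n. (1 - 1 / real (Suc k)) ^ n * D) \<longlonglongrightarrow> 0 * D"
    by (intro tendsto_mult LIMSEQ_realpow_zero tendsto_const) auto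
  then have "eventually (\<lambda>n. (1 - 1 / real (Suc k)) ^ n * D < \<eta>) sequentially"
    using \<eta>(1) by (intro order_tendstoD(2)) auto
  then obtain n where n: "(1 - 1 / real (Suc k)) ^ n * D < \<eta>"
    by (auto simp: eventually_sequentially)
  have sub: "length t = Suc j" "set t \<subseteq> Q" "\<And>u v. u \<in> set t \<Longrightarrow> v \<in> set t \<Longrightarrow> dist u v < \<eta>"
    if "j \<le> k" "t \<in> set (sds n (hemi e j))" for j t
  proof -
    note H = sds_hemi[OF that(2,1) D[unfolded Q_def]]
    show "length t = Suc j" using H by blast
    show "set t \<subseteq> Q" using H unfolding Q_def cross_sphere_def by blast
    show "dist u v < \<eta>" if "u \<in> set t" "v \<in> set t" for u v
      using H n that by (meson le_less_trans)
  qed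
  have "\<exists>t\<in>set (sds n (hemi e k)). distinct (map (\<lambda>v. \<bar>l v\<bar>) t)"
  proof (rule ky_fan)
    fix j t u v assume jt: "j \<le> k" "t \<in> set (sds n (hemi e j))"
    note st = sub[OF jt]
    show "t \<noteq> []" using st(1) by auto
    assume v: "v \<in> set t"
    then show "l (- v) = - l v" using l_uminus st(2) by blast
    assume u: "u \<in> set t"
    show "l u \<noteq> - l v" using compl st(2) st(3)[OF u v] u v by blast
  qed
  then obtain t where t: "t \<in> set (sds n (hemi e k))" "distinct (map (\<lambda>v. \<bar>l v\<bar>) t)" by blast
  note st = sub[OF order_refl t(1)]
  have "Suc k = card ((\<lambda>v. \<bar>l v\<bar>) ` set t)"
    using st(1) distinct_card[OF t(2)] by simp
  also have "\<dots> \<le> card {1..int m}"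
    using st(2) J(1) by (intro card_mono) (force simp: l_def)+
  finally show ?thesis by simp
qed

section \<open>Cuts, level sets and eigenvectors\<close>

lemma adj_sym: "(i, j) \<in> adj E \<longleftrightarrow> (j, i) \<in> adj E"
  by (simp add: adj_def insert_commute)

lemma vol_eq_card_adj: "vol E = card (adj E)"
proof -
  have "adj E = (SIGMA i:UNIV. {j. {i, j} \<in> E})" by (auto simp: adj_def)
  then show ?thesis by (simp add: vol_def deg_def)
qed

lemma vol_pos:
  assumes "simple_graph E" "E \<noteq> {}"
  shows "0 < vol E"
proof -
  obtain e where e: "e \<in> E" "card e = 2" using assms unfolding simple_graph_def by blast
  then obtain i j where "e = {i, j}" by (auto simp: card_2_iff)
  then have "(i, j) \<in> adj E" using e by (simp add: adj_def)
  then show ?thesis unfolding vol_eq_card_adj by (auto simp: card_gt_0_iff)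
qed

text \<open>Disjointness fixes which endpoint of an edge comes first, so each edge corresponds to
  exactly one ordered pair.\<close>

lemma card_edges_between:
  assumes "A \<inter> B = {}"
  shows "card (edges_between E A B) = card (adj E \<inter> A \<times> B)"
proof -
  have "edges_between E A B = (\<lambda>(i, j). {i, j}) ` (adj E \<inter> A \<times> B)"
    by (auto simp: edges_between_def adj_def)
  moreover have "inj_on (\<lambda>(i, j). {i, j}) (adj E \<inter> A \<times> B)"
    using assms by (auto simp: inj_on_def doubleton_eq_iff)
  ultimately show ?thesis by (simp add: card_image)
qed

lemma edges_between_commute: "edges_between E A B = edges_between E B A"
  by (auto simp: edges_between_def insert_commute)

lemma card_Int_Times_swap:
  assumes "sym R"
  shows "card (R \<inter> A \<times> B) = card (R \<inter> B \<times> A)"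
  by (rule bij_betw_same_card[of prod.swap], rule bij_betw_byWitness[where f'=prod.swap])
    (use assms in \<open>auto simp: sym_def\<close>)

lemma sym_adj: "sym (adj E)"
  using adj_sym by (auto simp: sym_def)

lemma sum_card_edges_between:
  assumes W: "disjoint_family_on W K" and IJ: "I \<subseteq> K" "J \<subseteq> K" "I \<inter> J = {}" and K: "finite K"
  shows "(\<Sum>i\<in>I. \<Sum>j\<in>J. card (edges_between E (W i) (W j))) =
    card (adj E \<inter> (\<Union>i\<in>I. W i) \<times> (\<Union>j\<in>J. W j))"
proof -
  have fin: "finite I" "finite J" using IJ K by (blast intro: finite_subset)+
  have "(\<Sum>i\<in>I. \<Sum>j\<in>J. card (edges_between E (W i) (W j))) = (\<Sum>i\<in>I. \<Sum>j\<in>J. card (adj E \<inter> W i \<times> W j))"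
  proof (intro sum.cong refl card_edges_between)
    fix i j assume "i \<in> I" "j \<in> J"
    with IJ have "i \<in> K" "j \<in> K" "i \<noteq> j" by auto
    with W show "W i \<inter> W j = {}" unfolding disjoint_family_on_def by blast
  qed
  also have "\<dots> = (\<Sum>p\<in>I \<times> J. card (adj E \<inter> W (fst p) \<times> W (snd p)))"
    by (simp add: sum.cartesian_product split_def)
  also have "\<dots> = card (\<Union>p\<in>I \<times> J. adj E \<inter> W (fst p) \<times> W (snd p))"
  proof (rule card_UN_disjoint[symmetric])
    show "\<forall>p\<in>I \<times> J. \<forall>q\<in>I \<times> J. p \<noteq> q \<longrightarrow>
      (adj E \<inter> W (fst p) \<times> W (snd p)) \<inter> (adj E \<inter> W (fst q) \<times> W (snd q)) = {}"
    proof (intro ballI impI)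
      fix p q assume "p \<in> I \<times> J" "q \<in> I \<times> J" "p \<noteq> q"
      then have "fst p \<in> K" "snd p \<in> K" "fst q \<in> K" "snd q \<in> K" "fst p \<noteq> fst q \<or> snd p \<noteq> snd q"
        using IJ by (auto simp: prod_eq_iff)
      with W have "W (fst p) \<inter> W (fst q) = {} \<or> W (snd p) \<inter> W (snd q) = {}"
        unfolding disjoint_family_on_def by blast
      then show "(adj E \<inter> W (fst p) \<times> W (snd p)) \<inter> (adj E \<inter> W (fst q) \<times> W (snd q)) = {}"
        by blast
    qed
  qed (use fin in auto)
  also have "(\<Union>p\<in>I \<times> J. adj E \<inter> W (fst p) \<times> W (snd p)) = adj E \<inter> (\<Union>i\<in>I. W i) \<times> (\<Union>j\<in>J. W j)"
    by auto
  finally show ?thesis .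
qed

text \<open>Disjointness merges the double sums into single cuts between unions, the form in which
  superlevel sets and unions of domains can be compared with them.\<close>

lemma MC_eq:
  assumes "disjoint_nonempty_family k W"
  defines "U \<equiv> \<Union>i\<in>{1..k}. W i"
  shows "MC E k W = 2 * (MAX S\<in>Pow {1..k}. card (adj E \<inter> (\<Union>i\<in>S. W i) \<times> (\<Union>j\<in>{1..k} - S. W j)))
    + card (adj E \<inter> U \<times> (UNIV - U))"
proof -
  have W: "disjoint_family_on W {1..k}"
    using assms(1) by (simp add: disjoint_nonempty_family_def)
  have "(\<Sum>i=1..k. card (edges_between E (W i) (UNIV - U))) = (\<Sum>i=1..k. card (adj E \<inter> W i \<times> (UNIV - U)))"
    by (intro sum.cong refl card_edges_between) (auto simp: U_def)
  also have "\<dots> = card (\<Union>i\<in>{1..k}. adj E \<inter> W i \<times> (UNIV - U))"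
    using W by (intro card_UN_disjoint[symmetric]) (auto simp: disjoint_family_on_def)
  also have "(\<Union>i\<in>{1..k}. adj E \<inter> W i \<times> (UNIV - U)) = adj E \<inter> U \<times> (UNIV - U)"
    by (auto simp: U_def)
  finally have 1: "(\<Sum>i=1..k. card (edges_between E (W i) (UNIV - U))) = card (adj E \<inter> U \<times> (UNIV - U))" .
  have "(\<Sum>i\<in>S. \<Sum>j\<in>{1..k} - S. card (edges_between E (W i) (W j))) =
      card (adj E \<inter> (\<Union>i\<in>S. W i) \<times> (\<Union>j\<in>{1..k} - S. W j))" if "S \<in> Pow {1..k}" for S
    using that by (intro sum_card_edges_between[OF W]) auto
  then have "(MAX S\<in>Pow {1..k}. \<Sum>i\<in>S. \<Sum>j\<in>{1..k} - S. card (edges_between E (W i) (W j))) =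
      (MAX S\<in>Pow {1..k}. card (adj E \<inter> (\<Union>i\<in>S. W i) \<times> (\<Union>j\<in>{1..k} - S. W j)))"
    by (intro arg_cong[where f=Max] image_cong refl)
  with 1 show ?thesis unfolding MC_def U_def by simp
qed

text \<open>Turns an unindexed set of disjoint sets, such as the nodal domains, into a competitor
  for \<open>multi_cut\<close>: under an enumeration the index sets \<open>S\<close> correspond to
  the subsets \<open>X\<close>.\<close>

lemma multi_cut_le:
  fixes N :: "'v::finite set set"
  assumes N: "disjoint N" "{} \<notin> N"
    and cut: "\<And>X. X \<subseteq> N \<Longrightarrow> card (edges_between E (\<Union>X) (\<Union>(N - X))) \<le> c"
  shows "multi_cut E (card N) \<le> 2 * c + card (adj E \<inter> \<Union>N \<times> (UNIV - \<Union>N))"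
proof -
  define m where "m = card N"
  obtain W where W: "bij_betw W {1..m} N"
    using ex_bij_betw_nat_finite_1[of N] unfolding m_def by auto
  then have img: "W ` {1..m} = N" and inj: "inj_on W {1..m}" by (auto simp: bij_betw_def)
  have fam: "disjoint_nonempty_family m W"
    unfolding disjoint_nonempty_family_def disjoint_family_on_def
  proof (intro conjI ballI impI)
    fix i j assume "i \<in> {1..m}" "j \<in> {1..m}" "i \<noteq> j"
    then show "W i \<inter> W j = {}"
      using N(1) img inj by (metis disjointD image_eqI inj_on_eq_iff)
  qed (use N(2) img in blast)
  have "card (adj E \<inter> (\<Union>i\<in>S. W i) \<times> (\<Union>j\<in>{1..m} - S. W j)) \<le> c" if "S \<in> Pow {1..m}" for S
  proof -
    have S: "W ` S \<subseteq> N" "W ` ({1..m} - S) = N - W ` S"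
      using that img inj_on_image_set_diff[OF inj, of "{1..m}" S] by auto
    have "\<Union>(W ` S) \<inter> \<Union>(N - W ` S) = {}"
      using N(1) S(1) unfolding disjoint_def by blast
    then have "card (adj E \<inter> \<Union>(W ` S) \<times> \<Union>(N - W ` S)) \<le> c"
      using cut[OF S(1)] by (simp add: card_edges_between)
    then show ?thesis using S(2) by simp
  qed
  then have "(MAX S\<in>Pow {1..m}. card (adj E \<inter> (\<Union>i\<in>S. W i) \<times> (\<Union>j\<in>{1..m} - S. W j))) \<le> c"
    by (intro Max.boundedI) auto
  then have "MC E m W \<le> 2 * c + card (adj E \<inter> \<Union>N \<times> (UNIV - \<Union>N))"
    unfolding MC_eq[OF fam] img by simp
  moreover have "multi_cut E m \<le> MC E m W"
    unfolding multi_cut_def using fam by (intro cINF_lower) auto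
  ultimately show ?thesis by (simp add: m_def)
qed

text \<open>An infimum of natural numbers over a nonempty set is attained, and \<open>k\<close>
  distinct singletons provide a family.\<close>

lemma multi_cut_attained:
  assumes "k \<le> CARD('v)"
  obtains W :: "nat \<Rightarrow> 'v::finite set" where "disjoint_nonempty_family k W" "multi_cut E k = MC E k W"
proof -
  obtain h :: "nat \<Rightarrow> 'v" where "bij_betw h {1..CARD('v)} UNIV"
    using ex_bij_betw_nat_finite_1[OF finite, of "UNIV :: 'v set"] by blast
  then have "inj_on h {1..k}"
    using assms by (intro inj_on_subset[OF bij_betw_imp_inj_on]) auto
  then have "disjoint_nonempty_family k (\<lambda>i. {h i})"
    unfolding disjoint_nonempty_family_def disjoint_family_on_def using inj_onD by fastforce
  then have "MC E k (\<lambda>i. {h i}) \<in> MC E k ` {W. disjoint_nonempty_family k W}"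
    by (intro imageI CollectI)
  then have "MC E k ` {W. disjoint_nonempty_family k W} \<noteq> {}" by (rule ex_in_conv[THEN iffD1, OF exI])
  from Inf_nat_def1[OF this] have "multi_cut E k \<in> MC E k ` {W. disjoint_nonempty_family k W}"
    unfolding multi_cut_def .
  then obtain W where "W \<in> {W. disjoint_nonempty_family k W}" "multi_cut E k = MC E k W" by (rule imageE)
  then show ?thesis using that by simp
qed

subsection \<open>Coarea formula\<close>

text \<open>A level \<open>t\<close> separates \<open>u\<close> and \<open>v\<close> when it lies
  between them; the endpoints are negligible for the integral.\<close>

lemma has_integral_level:
  fixes u v a b :: real
  assumes "u \<in> {a..b}" "v \<in> {a..b}"
  shows "((\<lambda>t. of_bool ((t < u) \<noteq> (t < v))) has_integral \<bar>u - v\<bar>) {a..b}"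
proof -
  have "((\<lambda>t. 1 :: real) has_integral \<bar>u - v\<bar>) (cbox (min u v) (max u v))"
    using has_integral_const_real[of "1::real" "min u v" "max u v"] by (cases "u \<le> v") auto
  then have "((\<lambda>t. if t \<in> cbox (min u v) (max u v) then 1 else 0 :: real) has_integral \<bar>u - v\<bar>) (cbox a b)"
    by (rule has_integral_restrict_closed_subinterval) (use assms in auto)
  then have "((\<lambda>t. of_bool ((t < u) \<noteq> (t < v)) :: real) has_integral \<bar>u - v\<bar>) (cbox a b)"
    by (rule has_integral_spike_finite[rotated 2, where S="{u, v}"]) (auto simp: min_def max_def split: if_splits)
  then show ?thesis by simp
qed

lemma coarea:
  fixes x :: "'a \<Rightarrow> real"
  assumes "finite P" "\<And>i j. (i, j) \<in> P \<Longrightarrow> x i \<in> {a..b} \<and> x j \<in> {a..b}"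
  shows "((\<lambda>t. \<Sum>(i, j)\<in>P. of_bool ((t < x i) \<noteq> (t < x j))) has_integral (\<Sum>(i, j)\<in>P. \<bar>x i - x j\<bar>)) {a..b}"
  using assms unfolding split_def by (intro has_integral_sum has_integral_level) auto

lemma sum_level_set:
  fixes P :: "('a \<times> 'a) set"
  assumes "finite P" "sym P"
  shows "(\<Sum>(i, j)\<in>P. of_bool ((i \<in> S) \<noteq> (j \<in> S)) :: real) = 2 * card (P \<inter> S \<times> (- S))"
proof -
  have "(\<Sum>(i, j)\<in>P. of_bool ((i \<in> S) \<noteq> (j \<in> S)) :: real) = (\<Sum>p\<in>P. of_bool (p \<in> S \<times> (- S) \<union> (- S) \<times> S))"
    by (intro sum.cong) auto
  also have "\<dots> = card (P \<inter> (S \<times> (- S) \<union> (- S) \<times> S))"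
    using assms(1) by (simp only: sum_of_bool_eq Collect_mem_eq)
  also have "P \<inter> (S \<times> (- S) \<union> (- S) \<times> S) = P \<inter> S \<times> (- S) \<union> P \<inter> (- S) \<times> S"
    by blast
  also have "card \<dots> = card (P \<inter> S \<times> (- S)) + card (P \<inter> (- S) \<times> S)"
    using assms(1) by (intro card_Un_disjoint) auto
  also have "card (P \<inter> (- S) \<times> S) = card (P \<inter> S \<times> (- S))"
    by (rule card_Int_Times_swap[OF assms(2)])
  finally show ?thesis by simp
qed

lemma sum_abs_diff_le:
  fixes x :: "'a \<Rightarrow> real"
  assumes P: "finite P" "sym P" "\<And>i j. (i, j) \<in> P \<Longrightarrow> x i \<in> {a..b} \<and> x j \<in> {a..b}" and "a \<le> b"
    and cut: "\<And>t. card (P \<inter> {i. t < x i} \<times> (- {i. t < x i})) \<le> c"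
  shows "(\<Sum>(i, j)\<in>P. \<bar>x i - x j\<bar>) \<le> 2 * real c * (b - a)"
proof (rule has_integral_le[OF coarea[OF P(1,3)]])
  show "((\<lambda>t. 2 * real c) has_integral 2 * real c * (b - a)) {a..b}"
    using has_integral_const_real[of "2 * real c" a b] \<open>a \<le> b\<close> by (simp add: mult_ac)
  show "(\<Sum>(i, j)\<in>P. of_bool ((t < x i) \<noteq> (t < x j))) \<le> 2 * real c" for t
    using sum_level_set[OF P(1,2), of "{i. t < x i}"] cut[of t] by simp
qed

lemma sum_abs_diff_ge:
  fixes x :: "'a \<Rightarrow> real"
  assumes P: "finite P" "sym P" "\<And>i j. (i, j) \<in> P \<Longrightarrow> x i \<in> {a..b} \<and> x j \<in> {a..b}" and "a \<le> b"
    and cut: "\<And>t. t \<in> {a..<b} \<Longrightarrow> c \<le> card (P \<inter> {i. t < x i} \<times> (- {i. t < x i}))"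
  shows "2 * real c * (b - a) \<le> (\<Sum>(i, j)\<in>P. \<bar>x i - x j\<bar>)"
proof -
  have "((\<lambda>t. 2 * real c) has_integral 2 * real c * (b - a)) {a..b}"
    using has_integral_const_real[of "2 * real c" a b] \<open>a \<le> b\<close> by (simp add: mult_ac)
  \<comment> \<open>At \<open>t = b\<close> the superlevel set cuts nothing and the lower bound may
    fail, so the integrand is changed at this single point.\<close>
  then have c: "((\<lambda>t. if t = b then 0 else 2 * real c) has_integral 2 * real c * (b - a)) {a..b}"
    by (rule has_integral_spike_finite[rotated 2, where S="{b}"]) auto
  show ?thesis
  proof (rule has_integral_le[OF c coarea[OF P(1,3)]])
    fix t assume "t \<in> {a..b}"
    then show "(if t = b then 0 else 2 * real c) \<le> (\<Sum>(i, j)\<in>P. of_bool ((t < x i) \<noteq> (t < x j)))"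
      using sum_level_set[OF P(1,2), of "{i. t < x i}"] cut[of t] by (auto intro!: sum_nonneg)
  qed
qed

subsection \<open>Components\<close>

lemma components_induced_props:
  shows "disjoint (components_induced E U)" "{} \<notin> components_induced E U"
    "\<Union>(components_induced E U) = U"
    "\<And>A p q. A \<in> components_induced E U \<Longrightarrow> p \<in> A \<Longrightarrow> q \<in> U \<Longrightarrow> (p, q) \<in> adj E \<Longrightarrow> q \<in> A"
proof -
  define R where "R = (adj E \<inter> U \<times> U)\<^sup>*"
  have sym: "sym R" unfolding R_def using adj_sym by (intro sym_rtrancl) (auto simp: sym_def)
  \<comment> \<open>The closure relates every vertex to itself, so it is an equivalence on the whole
    type; classes of points of \<open>U\<close> stay inside \<open>U\<close> because each step
    does.\<close>
  have eq: "equiv UNIV R"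
    using sym by (auto simp: equiv_def R_def refl_rtrancl trans_rtrancl)
  have comp: "components_induced E U = U // R" by (simp add: components_induced_def R_def)
  have sub: "U // R \<subseteq> UNIV // R" by (auto simp: quotient_def)
  show "disjoint (components_induced E U)"
    unfolding comp disjoint_def using quotient_disj[OF eq] sub by blast
  show "{} \<notin> components_induced E U"
    unfolding comp using in_quotient_imp_non_empty[OF eq] sub by blast
  have stay: "y \<in> U" if "(x, y) \<in> R" "x \<in> U" for x y
    using that unfolding R_def by (induction rule: rtrancl_induct) auto
  then show U: "\<Union>(components_induced E U) = U"
    unfolding comp quotient_def using eq by (auto simp: equiv_def refl_on_def)
  fix A p q assume A: "A \<in> components_induced E U" "p \<in> A" "q \<in> U" "(p, q) \<in> adj E"
  then have "p \<in> U" using U by blast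
  then have pq: "(p, q) \<in> R" unfolding R_def using A by auto
  obtain x where "A = R `` {x}" using A(1) unfolding comp quotient_def by blast
  then show "q \<in> A" using A(2) pq eq by (auto simp: equiv_def dest: transD)
qed

subsection \<open>Eigenvectors\<close>

lemma infnorm_le_iff: "infnorm (x :: real ^ 'n) \<le> b \<longleftrightarrow> (\<forall>i. \<bar>x $ i\<bar> \<le> b)"
proof
  show "\<forall>i. \<bar>x $ i\<bar> \<le> b" if "infnorm x \<le> b"
    using that component_le_infnorm_cart[of x] by (meson order_trans)
  show "infnorm x \<le> b" if "\<forall>i. \<bar>x $ i\<bar> \<le> b"
    unfolding infnorm_cart using that by (intro cSup_least) auto
qed

lemma infnorm_attained:
  obtains i where "\<bar>(x :: real ^ 'n) $ i\<bar> = infnorm x"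
proof -
  define b where "b = (MAX i. \<bar>x $ i\<bar>)"
  have "b \<in> range (\<lambda>i. \<bar>x $ i\<bar>)" unfolding b_def by (intro Max_in) auto
  then obtain i where i: "\<bar>x $ i\<bar> = b" by auto
  have "infnorm x \<le> b" unfolding infnorm_le_iff b_def by (auto intro: Max_ge)
  with i component_le_infnorm_cart[of x i] that show ?thesis by force
qed

text \<open>Comparing \<open>x\<close> with \<open>0\<close> and with twice \<open>x\<close> gives
  both inequalities for \<open>u \<bullet> x\<close>. A coordinate strictly below the maximum can
  move a little either way without raising the norm, so \<open>u\<close> vanishes there.\<close>

lemma subdifferential_infnorm:
  fixes u x :: "real ^ 'n"
  assumes u: "u \<in> subdifferential infnorm x"
  shows "u \<bullet> x = infnorm x" "i \<in> D_zero x \<Longrightarrow> u $ i = 0"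
proof -
  have sub: "infnorm x + u \<bullet> (y - x) \<le> infnorm y" for y
    using u by (simp add: subdifferential_def)
  show "u \<bullet> x = infnorm x"
    using sub[of 0] sub[of "2 *\<^sub>R x"] by (simp add: infnorm_0 infnorm_mul inner_diff_right)
  assume i: "i \<in> D_zero x"
  define \<epsilon> where "\<epsilon> = infnorm x - \<bar>x $ i\<bar>"
  have \<epsilon>: "\<epsilon> > 0" using i by (simp add: \<epsilon>_def D_zero_def)
  have "s * u $ i \<le> 0" if "\<bar>s\<bar> = \<epsilon>" for s
  proof -
    have "\<bar>(x + s *\<^sub>R axis i 1) $ j\<bar> \<le> infnorm x" for j
      using that component_le_infnorm_cart[of x j] by (auto simp: axis_def \<epsilon>_def)
    then have "infnorm (x + s *\<^sub>R axis i 1) \<le> infnorm x" by (simp add: infnorm_le_iff)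
    with sub[of "x + s *\<^sub>R axis i 1"] show ?thesis by (simp add: inner_axis)
  qed
  from this[of \<epsilon>] this[of "- \<epsilon>"] \<epsilon> show "u $ i = 0"
    by (simp add: mult_le_0_iff zero_le_mult_iff)
qed

lemma sum_antisym:
  fixes z :: "'a \<Rightarrow> 'a \<Rightarrow> real"
  assumes "sym P" "\<And>i j. (i, j) \<in> P \<Longrightarrow> z i j = - z j i"
  shows "(\<Sum>(i, j)\<in>P. z i j) = 0"
proof -
  have "(\<Sum>(i, j)\<in>P. z i j) = (\<Sum>(i, j)\<in>P. z j i)"
    by (rule sum.reindex_bij_witness[of _ prod.swap prod.swap]) (use assms(1) in \<open>auto simp: sym_def\<close>)
  also have "\<dots> = (\<Sum>(i, j)\<in>P. - z i j)"
    using assms(2) by (intro sum.cong) force+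
  also have "\<dots> = - (\<Sum>(i, j)\<in>P. z i j)"
    by (simp add: sum_negf split_def)
  finally show ?thesis by simp
qed

lemma eigenvalue_eq_cut:
  fixes E :: "'v::finite set set" and \<mu> :: real
  assumes "eigenpair_M E \<mu> x"
  shows "\<mu> * vol E = card (adj E \<inter> D_plus x \<times> (- D_plus x)) + card (adj E \<inter> D_minus x \<times> (- D_minus x))"
proof -
  define N where "N = infnorm x"
  define L where "L = \<mu> * vol E"
  have N: "N > 0" using assms by (simp add: eigenpair_M_def N_def infnorm_pos_lt)
  obtain u where u: "u \<in> subdifferential infnorm x" and "L *\<^sub>R u \<in> one_laplacian E x"
    using assms unfolding eigenpair_M_def L_def by blast
  then obtain z where zu: "L *\<^sub>R u = (\<chi> i. \<Sum>j | {i, j} \<in> E. z i j)"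
    and "\<forall>i j. {i, j} \<in> E \<longrightarrow> z i j \<in> Sgn (x $ i - x $ j) \<and> z i j = - z j i"
    unfolding one_laplacian_def by blast
  then have z: "\<And>i j. (i, j) \<in> adj E \<Longrightarrow> z i j \<in> Sgn (x $ i - x $ j)" "\<And>i j. (i, j) \<in> adj E \<Longrightarrow> z i j = - z j i"
    unfolding adj_def by blast+
  have zu: "(\<Sum>j | {i, j} \<in> E. z i j) = L * u $ i" for i
    using arg_cong[OF zu, of "\<lambda>y. y $ i"] by simp
  have le: "\<bar>x $ i\<bar> \<le> N" for i unfolding N_def by (rule component_le_infnorm_cart)
  have sum_D: "L * (\<Sum>i\<in>D. u $ i) = (\<Sum>(i, j)\<in>adj E \<inter> D \<times> (- D). z i j)" for D
  proof -
    have "L * (\<Sum>i\<in>D. u $ i) = (\<Sum>i\<in>D. \<Sum>j | {i, j} \<in> E. z i j)"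
      by (simp add: zu sum_distrib_left)
    also have "\<dots> = (\<Sum>(i, j)\<in>(SIGMA i:D. {j. {i, j} \<in> E}). z i j)"
      by (intro sum.Sigma) auto
    also have "(SIGMA i:D. {j. {i, j} \<in> E}) = (adj E \<inter> D \<times> D) \<union> (adj E \<inter> D \<times> (- D))"
      by (auto simp: adj_def)
    also have "(\<Sum>(i, j)\<in>\<dots>. z i j) = (\<Sum>(i, j)\<in>adj E \<inter> D \<times> D. z i j) + (\<Sum>(i, j)\<in>adj E \<inter> D \<times> (- D). z i j)"
      by (intro sum.union_disjoint) auto
    also have "(\<Sum>(i, j)\<in>adj E \<inter> D \<times> D. z i j) = 0"
    proof (rule sum_antisym)
      show "sym (adj E \<inter> D \<times> D)" using sym_adj[of E] by (auto simp: sym_def)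
    qed (use z(2) in blast)
    finally show ?thesis by simp
  qed
  \<comment> \<open>A vertex outside \<open>D_plus x\<close> has a strictly smaller value, so
    \<open>Sgn\<close> forces \<open>z i j = 1\<close> on every leaving edge.\<close>
  have "(\<Sum>(i, j)\<in>adj E \<inter> D_plus x \<times> (- D_plus x). z i j) = (\<Sum>(i, j)\<in>adj E \<inter> D_plus x \<times> (- D_plus x). 1)"
  proof (intro sum.cong refl, clarify)
    fix i j assume ij: "(i, j) \<in> adj E" "i \<in> D_plus x" "j \<notin> D_plus x"
    then have "x $ i - x $ j > 0" using le[of j] by (auto simp: D_plus_def N_def)
    then show "z i j = 1" using z(1)[OF ij(1)] by (simp add: Sgn_def)
  qed
  then have plus: "L * (\<Sum>i\<in>D_plus x. u $ i) = card (adj E \<inter> D_plus x \<times> (- D_plus x))"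
    unfolding sum_D by simp
  have "(\<Sum>(i, j)\<in>adj E \<inter> D_minus x \<times> (- D_minus x). z i j) = (\<Sum>(i, j)\<in>adj E \<inter> D_minus x \<times> (- D_minus x). - 1)"
  proof (intro sum.cong refl, clarify)
    fix i j assume ij: "(i, j) \<in> adj E" "i \<in> D_minus x" "j \<notin> D_minus x"
    then have "x $ i - x $ j < 0" using le[of j] by (auto simp: D_minus_def N_def)
    then show "z i j = - 1" using z(1)[OF ij(1)] by (simp add: Sgn_def)
  qed
  then have minus: "L * (\<Sum>i\<in>D_minus x. u $ i) = - card (adj E \<inter> D_minus x \<times> (- D_minus x))"
    unfolding sum_D by simp
  have cover: "UNIV = D_plus x \<union> D_minus x \<union> D_zero x"
  proof (intro equalityI subsetI)
    fix i show "i \<in> D_plus x \<union> D_minus x \<union> D_zero x"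
      using le[of i] by (auto simp: D_plus_def D_minus_def D_zero_def N_def abs_if)
  qed simp
  have disj: "D_plus x \<inter> D_minus x = {}" "(D_plus x \<union> D_minus x) \<inter> D_zero x = {}"
    using N by (auto simp: D_plus_def D_minus_def D_zero_def N_def)
  \<comment> \<open>On the three vertex classes \<open>x\<close> is \<open>N\<close>,
    \<open>- N\<close>, or multiplied by a vanishing entry of \<open>u\<close>; dividing by
    \<open>N\<close>, the total of \<open>u\<close> on \<open>D_plus x\<close> minus that on
    \<open>D_minus x\<close> is 1.\<close>
  have "N = (\<Sum>i\<in>UNIV. u $ i * x $ i)"
    using subdifferential_infnorm(1)[OF u] by (simp add: inner_vec_def N_def)
  also have "\<dots> = (\<Sum>i\<in>D_plus x. u $ i * x $ i) + (\<Sum>i\<in>D_minus x. u $ i * x $ i) + (\<Sum>i\<in>D_zero x. u $ i * x $ i)"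
    unfolding cover sum.union_disjoint[OF finite finite disj(2)] sum.union_disjoint[OF finite finite disj(1)] ..
  also have "(\<Sum>i\<in>D_zero x. u $ i * x $ i) = 0"
    using subdifferential_infnorm(2)[OF u] by simp
  also have "(\<Sum>i\<in>D_plus x. u $ i * x $ i) = N * (\<Sum>i\<in>D_plus x. u $ i)"
    by (simp add: sum_distrib_left D_plus_def N_def mult.commute)
  also have "(\<Sum>i\<in>D_minus x. u $ i * x $ i) = N * - (\<Sum>i\<in>D_minus x. u $ i)"
    unfolding sum_negf[symmetric] sum_distrib_left
  proof (intro sum.cong refl)
    fix i assume "i \<in> D_minus x"
    then have "x $ i = - N" by (simp add: D_minus_def N_def)
    then show "u $ i * x $ i = N * - (u $ i)" by simp
  qed
  finally have "N * ((\<Sum>i\<in>D_plus x. u $ i) - (\<Sum>i\<in>D_minus x. u $ i)) = N * 1"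
    by (simp add: right_diff_distrib)
  then have "(\<Sum>i\<in>D_plus x. u $ i) - (\<Sum>i\<in>D_minus x. u $ i) = 1"
    using N by simp
  then have "L = L * (\<Sum>i\<in>D_plus x. u $ i) - L * (\<Sum>i\<in>D_minus x. u $ i)"
    unfolding right_diff_distrib[symmetric] by simp
  then show ?thesis using plus minus unfolding L_def by linarith
qed

lemma multi_cut_le_eigenvalue:
  fixes E :: "'v::finite set set" and \<mu> :: real
  assumes eig: "eigenpair_M E \<mu> x" and m: "card (nodal_domains E x) = m \<or> card (null_domains E x) = m"
  shows "real (multi_cut E m) \<le> \<mu> * real (vol E)"
proof -
  define P M Z where "P = D_plus x" and "M = D_minus x" and "Z = D_zero x"
  have N: "infnorm x > 0" using eig by (simp add: eigenpair_M_def infnorm_pos_lt)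
  have le: "\<bar>x $ i\<bar> \<le> infnorm x" for i by (rule component_le_infnorm_cart)
  have "i \<in> P \<or> i \<in> M \<or> i \<in> Z" for i
    using le[of i] by (auto simp: P_def M_def Z_def D_plus_def D_minus_def D_zero_def abs_if)
  moreover have disj: "P \<inter> M = {}" "P \<inter> Z = {}" "M \<inter> Z = {}"
    using N by (auto simp: P_def M_def Z_def D_plus_def D_minus_def D_zero_def)
  ultimately have cover: "UNIV - (P \<union> M) = Z" "- P = M \<union> Z" "- M = P \<union> Z" "UNIV - Z = P \<union> M"
    by blast+
  have card_Un: "card (adj E \<inter> A \<times> (B \<union> C)) = card (adj E \<inter> A \<times> B) + card (adj E \<inter> A \<times> C)" if "B \<inter> C = {}" for A B C
    unfolding Sigma_Un_distrib2 Int_Un_distrib using that by (intro card_Un_disjoint) auto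
  have sw: "card (adj E \<inter> A \<times> B) = card (adj E \<inter> B \<times> A)" for A B
    by (rule card_Int_Times_swap[OF sym_adj])
  \<comment> \<open>Edges between \<open>P\<close> and \<open>M\<close> leave both sets and count
    twice; edges to \<open>Z\<close> leave one of them and count once.\<close>
  have L: "\<mu> * vol E = 2 * card (adj E \<inter> P \<times> M) + card (adj E \<inter> Z \<times> (P \<union> M))"
    using eigenvalue_eq_cut[OF eig] disj sw[of M P] sw[of P Z] sw[of M Z]
    unfolding P_def[symmetric] M_def[symmetric] cover by (simp add: card_Un[OF disj(1)] card_Un[OF disj(2)] card_Un[OF disj(3)])
  note C = components_induced_props
  from m show ?thesis
  proof
    assume m: "card (nodal_domains E x) = m"
    define D where "D = nodal_domains E x"
    have D: "D = components_induced E P \<union> components_induced E M"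
      by (simp add: D_def nodal_domains_def P_def M_def)
    have U: "\<Union>D = P \<union> M" unfolding D Union_Un_distrib C(3) ..
    have dis: "disjoint D"
      unfolding D
    proof (rule disjoint_union[OF C(1) C(1)])
      show "\<Union>(components_induced E P) \<inter> \<Union>(components_induced E M) = {}" unfolding C(3) by (rule disj(1))
    qed
    have "multi_cut E (card D) \<le> 2 * card (edges_between E P M) + card (adj E \<inter> \<Union>D \<times> (UNIV - \<Union>D))"
    proof (rule multi_cut_le[OF dis])
      show "{} \<notin> D" unfolding D using C(2) by blast
      fix X assume X: "X \<subseteq> D"
      have "edges_between E (\<Union>X) (\<Union>(D - X)) \<subseteq> edges_between E P M"
      proof
        fix e assume "e \<in> edges_between E (\<Union>X) (\<Union>(D - X))"
        then obtain i j where "e \<in> E" "e = {i, j}" "i \<in> \<Union>X" "j \<in> \<Union>(D - X)"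
          unfolding edges_between_def by blast
        then obtain A B where e: "e \<in> E" "e = {i, j}" "A \<in> D" "B \<in> D" "A \<noteq> B" "i \<in> A" "j \<in> B"
          using X by blast
        have ij: "(i, j) \<in> adj E" using e by (simp add: adj_def)
        \<comment> \<open>Adjacent vertices of the same sign lie in one component, so only edges
          between opposite signs join different domains.\<close>
        have no: "False" if "A \<in> components_induced E V" "B \<in> components_induced E V" for V
        proof -
          have "j \<in> V" using C(3)[of E V] that(2) e(7) by blast
          then have "j \<in> A" by (rule C(4)[OF that(1) e(6) _ ij])
          then show False using disjointD[OF C(1) that e(5)] e(7) by blast
        qed
        have "i \<in> P \<and> j \<in> M \<or> i \<in> M \<and> j \<in> P"
        proof -
          have sub: "\<And>V A. A \<in> components_induced E V \<Longrightarrow> A \<subseteq> V" using C(3) by blast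
          consider "A \<in> components_induced E P" "B \<in> components_induced E M"
            | "A \<in> components_induced E M" "B \<in> components_induced E P"
            using e(3,4) no unfolding D by blast
          then show ?thesis using sub e(6,7) by cases blast+
        qed
        then show "e \<in> edges_between E P M"
          using e(1,2) unfolding edges_between_def by blast
      qed
      then show "card (edges_between E (\<Union>X) (\<Union>(D - X))) \<le> card (edges_between E P M)"
        by (intro card_mono) auto
    qed
    then have "multi_cut E m \<le> 2 * card (adj E \<inter> P \<times> M) + card (adj E \<inter> (P \<union> M) \<times> Z)"
      using m disj(1) unfolding U cover by (simp add: card_edges_between D_def)
    then show ?thesis using L sw[of Z "P \<union> M"] by simp
  next
    assume m: "card (null_domains E x) = m"
    define D where "D = components_induced E Z"
    \<comment> \<open>Distinct null domains have no edges between them; what remains are the edges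
      leaving \<open>Z\<close>, one summand of \<open>L\<close>.\<close>
    have "multi_cut E (card D) \<le> 2 * 0 + card (adj E \<inter> \<Union>D \<times> (UNIV - \<Union>D))"
      unfolding D_def
    proof (rule multi_cut_le[OF C(1,2)])
      fix X assume X: "X \<subseteq> components_induced E Z"
      have "edges_between E (\<Union>X) (\<Union>(components_induced E Z - X)) = {}"
      proof (rule ccontr)
        assume "\<not> ?thesis"
        then obtain A B i j where e: "{i, j} \<in> E" "A \<in> X" "B \<in> components_induced E Z - X" "i \<in> A" "j \<in> B"
          unfolding edges_between_def by blast
        have AB: "A \<in> components_induced E Z" "B \<in> components_induced E Z" "A \<noteq> B"
          using e(2,3) X by auto
        have "j \<in> Z" using C(3)[of E Z] AB(2) e(5) by blast
        then have "j \<in> A" using C(4)[OF AB(1) e(4)] e(1) by (simp add: adj_def)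
        then show False using disjointD[OF C(1) AB] e(5) by blast
      qed
      then show "card (edges_between E (\<Union>X) (\<Union>(components_induced E Z - X))) \<le> 0" by simp
    qed
    then have "multi_cut E m \<le> card (adj E \<inter> Z \<times> (P \<union> M))"
      using m by (simp add: D_def null_domains_def Z_def[symmetric] C(3) cover)
    then show ?thesis using L by simp
  qed
qed

section \<open>Min-max values\<close>

lemma genus_ge_iff: "enat k \<le> genus A \<longleftrightarrow> (\<forall>m. odd_map_to A m \<longrightarrow> k \<le> m)"
  by (simp add: genus_def le_INF_iff)

text \<open>Monotonicity of the genus: an odd continuous map from \<open>B\<close> to
  \<open>A\<close> pulls odd maps on \<open>A\<close> back to \<open>B\<close>.\<close>

lemma odd_map_to_compose:
  assumes "odd_map_to A m" "continuous_on B f" "f ` B \<subseteq> A" "\<And>x. x \<in> B \<Longrightarrow> f (- x) = - f x"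
  shows "odd_map_to B m"
proof -
  obtain h :: "'a \<Rightarrow> nat \<Rightarrow> real" where h: "\<And>j. j < m \<Longrightarrow> continuous_on A (\<lambda>x. h x j)"
    "\<And>x j. x \<in> A \<Longrightarrow> j < m \<Longrightarrow> h (- x) j = - h x j" "\<And>x. x \<in> A \<Longrightarrow> \<exists>j<m. h x j \<noteq> 0"
    using assms(1) unfolding odd_map_to_def by blast
  show ?thesis
    unfolding odd_map_to_def
  proof (intro exI[of _ "\<lambda>x. h (f x)"] conjI ballI allI impI)
    show "continuous_on B (\<lambda>x. h (f x) j)" if "j < m" for j
      by (rule continuous_on_compose2[OF h(1)[OF that] assms(2,3)])
    fix x assume x: "x \<in> B"
    then have fx: "f x \<in> A" using assms(3) by blast
    show "h (f (- x)) j = - h (f x) j" if "j < m" for j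
      unfolding assms(4)[OF x] by (rule h(2)[OF fx that])
    show "\<exists>j<m. h (f x) j \<noteq> 0" by (rule h(3)[OF fx])
  qed
qed

definition admissible :: "nat \<Rightarrow> (real ^ 'v::finite) set set" where
  "admissible k = {A. A \<subseteq> {x. infnorm x = 1} \<and> compact A \<and> A = uminus ` A \<and> genus A \<ge> enat k}"

text \<open>The empty set has genus 0. Nonemptiness makes the real supremum over \<open>A\<close>
  meaningful.\<close>

lemma admissible_nonempty: "A \<in> admissible k \<Longrightarrow> 1 \<le> k \<Longrightarrow> A \<noteq> {}"
proof
  assume A: "A \<in> admissible k" "1 \<le> k" "A = {}"
  have "odd_map_to ({} :: (real ^ 'a) set) 0" unfolding odd_map_to_def by simp
  then have "k \<le> 0" using A(1,3) unfolding admissible_def genus_ge_iff by blast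
  then show False using A(2) by simp
qed

lemma total_variation_le_vol:
  assumes "infnorm x = 1"
  shows "total_variation E x \<le> vol E"
proof -
  have "\<bar>x $ i - x $ j\<bar> \<le> 2" for i j
    using component_le_infnorm_cart[of x i] component_le_infnorm_cart[of x j] assms by simp
  then have "(\<Sum>(i, j)\<in>adj E. \<bar>x $ i - x $ j\<bar>) \<le> (\<Sum>(i, j)\<in>adj E. 2)"
    by (intro sum_mono) auto
  then show ?thesis by (simp add: total_variation_def vol_eq_card_adj split_def)
qed

lemma total_variation_nonneg: "0 \<le> total_variation E x"
  by (auto simp: total_variation_def intro!: sum_nonneg divide_nonneg_pos)

context
  fixes E :: "'v::finite set set"
  assumes graph: "simple_graph E" "E \<noteq> {}"
begin

definition max_ratio :: "(real ^ 'v) set \<Rightarrow> real" where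
  "max_ratio A = (SUP x\<in>A. total_variation E x / (real (vol E) * infnorm x))"

lemma minmax_value_eq: "minmax_value E k = (INF A\<in>admissible k. max_ratio A)"
  by (simp add: minmax_value_def admissible_def max_ratio_def)

lemma ratio_le_max_ratio:
  assumes "A \<in> admissible k" "x \<in> A"
  shows "total_variation E x / real (vol E) \<le> max_ratio A"
proof -
  have A: "infnorm y = 1" if "y \<in> A" for y using assms(1) that by (auto simp: admissible_def)
  \<comment> \<open>On the unit sphere the values at the ends of an edge differ by at most 2, and
    \<open>vol\<close> counts each edge twice, so the ratio is at most 1.\<close>
  have "bdd_above ((\<lambda>x. total_variation E x / (real (vol E) * infnorm x)) ` A)"
  proof (rule bdd_aboveI2)
    fix y assume "y \<in> A"
    then show "total_variation E y / (real (vol E) * infnorm y) \<le> 1"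
      using A total_variation_le_vol[of y E] vol_pos[OF graph] by (simp add: divide_le_eq)
  qed
  then have "total_variation E x / (real (vol E) * infnorm x) \<le> max_ratio A"
    unfolding max_ratio_def using assms(2) by (rule cSUP_upper[rotated])
  then show ?thesis using A[OF assms(2)] by simp
qed

lemma minmax_le:
  assumes A: "A \<in> admissible k" and k: "1 \<le> k" and le: "\<And>x. x \<in> A \<Longrightarrow> total_variation E x \<le> c"
  shows "vol E * minmax_value E k \<le> c"
proof -
  have ne: "A \<noteq> {}" using admissible_nonempty[OF A k] .
  have "0 \<le> max_ratio B" if B: "B \<in> admissible k" for B
  proof -
    obtain x where x: "x \<in> B" using admissible_nonempty[OF B k] by blast
    have "0 \<le> total_variation E x / real (vol E)"
      by (intro divide_nonneg_nonneg total_variation_nonneg) simp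
    also have "\<dots> \<le> max_ratio B" by (rule ratio_le_max_ratio[OF B x])
    finally show ?thesis .
  qed
  then have "bdd_below (max_ratio ` admissible k)" by (intro bdd_belowI[of _ 0]) auto
  then have "minmax_value E k \<le> max_ratio A"
    unfolding minmax_value_eq using A by (rule cINF_lower)
  also have "\<dots> \<le> c / vol E"
    unfolding max_ratio_def using ne
  proof (rule cSUP_least)
    fix x assume x: "x \<in> A"
    then have "infnorm x = 1" using A by (auto simp: admissible_def)
    then show "total_variation E x / (real (vol E) * infnorm x) \<le> c / vol E"
      using le[OF x] by (simp add: divide_right_mono)
  qed
  finally show ?thesis using vol_pos[OF graph] by (simp add: field_simps)
qed

lemma minmax_ge:
  assumes "admissible k \<noteq> ({} :: (real ^ 'v) set set)"
    and ge: "\<And>A. A \<in> admissible k \<Longrightarrow> \<exists>x\<in>A. c \<le> total_variation E x"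
  shows "c \<le> vol E * minmax_value E k"
proof -
  have "c / vol E \<le> minmax_value E k"
    unfolding minmax_value_eq using assms(1)
  proof (rule cINF_greatest)
    fix A :: "(real ^ 'v) set" assume A: "A \<in> admissible k"
    then obtain x where x: "x \<in> A" "c \<le> total_variation E x" using ge by blast
    have "c / vol E \<le> total_variation E x / vol E" using x(2) by (simp add: divide_right_mono)
    also have "\<dots> \<le> max_ratio A" by (rule ratio_le_max_ratio[OF A x(1)])
    finally show "c / vol E \<le> max_ratio A" .
  qed
  then show ?thesis using vol_pos[OF graph] by (simp add: field_simps)
qed

end

section \<open>Step functions and the upper bound by multi-way cuts\<close>

definition step_sphere :: "nat \<Rightarrow> (nat \<Rightarrow> 'v set) \<Rightarrow> (real ^ 'v::finite) set" where
  "step_sphere k W = {x. infnorm x = 1 \<and>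
     (\<forall>i p q. i \<in> {1..k} \<and> p \<in> W i \<and> q \<in> W i \<longrightarrow> x $ p = x $ q) \<and>
     (\<forall>p. p \<notin> (\<Union>i\<in>{1..k}. W i) \<longrightarrow> x $ p = 0)}"

lemma compact_step_sphere: "compact (step_sphere k W)"
proof -
  have "closed (step_sphere k W)"
    unfolding step_sphere_def
    by (intro closed_Collect_conj closed_Collect_all closed_Collect_imp closed_Collect_eq open_Collect_const
        continuous_intros)
  moreover have "bounded (step_sphere k W)"
  proof (rule boundedI)
    fix x assume "x \<in> step_sphere k W"
    then show "norm x \<le> sqrt DIM(real ^ 'a)"
      using norm_le_infnorm[of x] by (simp add: step_sphere_def)
  qed
  ultimately show ?thesis by (simp add: compact_eq_bounded_closed)
qed

lemma uminus_step_sphere: "x \<in> step_sphere k W \<Longrightarrow> - x \<in> step_sphere k W"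
  by (simp add: step_sphere_def infnorm_neg)

text \<open>\<open>step_sphere k W\<close> is the maximum-norm unit sphere of the span of the
  indicator vectors of the \<open>W i\<close>. Radial scaling maps the cross-polytope sphere on
  these vectors oddly and continuously into it, so an odd map to dimension \<open>m\<close> pulls
  back and Borsuk-Ulam gives \<open>l < m\<close>, that is \<open>k \<le> m\<close>.\<close>

lemma step_sphere_admissible:
  fixes W :: "nat \<Rightarrow> 'v::finite set"
  assumes W: "disjoint_nonempty_family k W" and k: "1 \<le> k"
  shows "step_sphere k W \<in> admissible k"
proof -
  obtain l where l: "k = Suc l" using k by (cases k) auto
  define e :: "nat \<Rightarrow> real ^ 'v" where "e i = (\<chi> p. of_bool (p \<in> W (Suc i)))" for i
  obtain w where w: "\<And>i. i \<in> {1..k} \<Longrightarrow> w i \<in> W i"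
  proof
    show "(SOME p. p \<in> W i) \<in> W i" if "i \<in> {1..k}" for i
      using W that unfolding disjoint_nonempty_family_def by (simp add: some_in_eq)
  qed
  have mem: "p \<in> W i \<longleftrightarrow> i = j" if "p \<in> W j" "i \<in> {1..k}" "j \<in> {1..k}" for p i j
    using W that unfolding disjoint_nonempty_family_def disjoint_family_on_def by blast
  have oct: "x \<noteq> 0 \<and> x /\<^sub>R infnorm x \<in> step_sphere k W" if "x \<in> octant e l S" for x S
  proof -
    define s :: "nat \<Rightarrow> real" where "s i = (if i \<in> S then 1 else - 1)" for i
    \<comment> \<open>With representatives \<open>w\<close>, the signed sum equals 1 at all vertices
      of this facet and hence on the facet, which keeps it away from the origin; the other
      conditions are linear and also pass to the hull.\<close>
    define C where "C = {x :: real ^ 'v. (\<Sum>i\<le>l. s i * x $ w (Suc i)) = 1} \<inter>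
      {x. \<forall>i p q. i \<in> {1..k} \<and> p \<in> W i \<and> q \<in> W i \<longrightarrow> x $ p = x $ q} \<inter>
      {x. \<forall>p. p \<notin> (\<Union>i\<in>{1..k}. W i) \<longrightarrow> x $ p = 0}"
    have "convex C"
      unfolding C_def
    proof (intro convex_Int)
      show "convex {x :: real ^ 'v. (\<Sum>i\<le>l. s i * x $ w (Suc i)) = 1}"
      proof (rule convexI, clarsimp)
        fix x y :: "real ^ 'v" and u v :: real
        assume a: "(\<Sum>i\<le>l. s i * x $ w (Suc i)) = 1" "(\<Sum>i\<le>l. s i * y $ w (Suc i)) = 1" "u + v = 1"
        have "(\<Sum>i\<le>l. s i * (u * x $ w (Suc i) + v * y $ w (Suc i))) =
            u * (\<Sum>i\<le>l. s i * x $ w (Suc i)) + v * (\<Sum>i\<le>l. s i * y $ w (Suc i))"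
          by (simp add: sum_distrib_left distrib_left sum.distrib mult.left_commute)
        then show "(\<Sum>i\<le>l. s i * (u * x $ w (Suc i) + v * y $ w (Suc i))) = 1" using a by simp
      qed
      show "convex {x :: real ^ 'v. \<forall>i p q. i \<in> {1..k} \<and> p \<in> W i \<and> q \<in> W i \<longrightarrow> x $ p = x $ q}"
      proof (rule convexI, intro CollectI allI impI)
        fix x y :: "real ^ 'v" and u v :: real and i p q
        assume x: "x \<in> {x. \<forall>i p q. i \<in> {1..k} \<and> p \<in> W i \<and> q \<in> W i \<longrightarrow> x $ p = x $ q}"
          and y: "y \<in> {x. \<forall>i p q. i \<in> {1..k} \<and> p \<in> W i \<and> q \<in> W i \<longrightarrow> x $ p = x $ q}"
          and pq: "i \<in> {1..k} \<and> p \<in> W i \<and> q \<in> W i"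
        have "x $ p = x $ q" "y $ p = y $ q" using x y pq by blast+
        then show "(u *\<^sub>R x + v *\<^sub>R y) $ p = (u *\<^sub>R x + v *\<^sub>R y) $ q" by simp
      qed
      show "convex {x :: real ^ 'v. \<forall>p. p \<notin> (\<Union>i\<in>{1..k}. W i) \<longrightarrow> x $ p = 0}"
        by (rule convexI) simp
    qed
    moreover have gen: "(if i \<in> S then e i else - e i) \<in> C" if i: "i \<le> l" for i
    proof -
      have "e i $ w (Suc j) = of_bool (i = j)" if "j \<le> l" for j
        using mem[OF w[of "Suc j"], of "Suc i"] i that by (auto simp: e_def l)
      then have "(\<Sum>j\<le>l. s j * (s i * e i $ w (Suc j))) = (\<Sum>j\<le>l. if i = j then s j * s i else 0)"
        by (intro sum.cong) auto
      also have "\<dots> = 1" using i by (simp add: s_def)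
      finally have "(\<Sum>j\<le>l. s j * (s i *\<^sub>R e i) $ w (Suc j)) = 1" by simp
      moreover have "(s i *\<^sub>R e i) $ p = (s i *\<^sub>R e i) $ q" if "j \<in> {1..k}" "p \<in> W j" "q \<in> W j" for j p q
        using mem[of p j "Suc i"] mem[of q j "Suc i"] that i by (simp add: e_def l)
      moreover have "(s i *\<^sub>R e i) $ p = 0" if "p \<notin> (\<Union>j\<in>{1..k}. W j)" for p
        using that i by (auto simp: e_def l)
      ultimately have "s i *\<^sub>R e i \<in> C" unfolding C_def by blast
      then show ?thesis by (simp add: s_def split: if_splits)
    qed
    ultimately have "octant e l S \<subseteq> C"
      unfolding octant_def by (intro hull_minimal image_subsetI gen) simp_all
    with that have "x \<in> C" by blast
    then have xC: "((\<Sum>i\<le>l. s i * x $ w (Suc i)) = 1 \<and>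
        (\<forall>i p q. i \<in> {1..k} \<and> p \<in> W i \<and> q \<in> W i \<longrightarrow> x $ p = x $ q)) \<and>
        (\<forall>p. p \<notin> (\<Union>i\<in>{1..k}. W i) \<longrightarrow> x $ p = 0)"
      unfolding C_def Int_iff mem_Collect_eq .
    have "x \<noteq> 0" using xC[THEN conjunct1, THEN conjunct1] by auto
    moreover from this have "infnorm (x /\<^sub>R infnorm x) = 1"
      using infnorm_pos_lt[of x] by (simp add: infnorm_mul)
    moreover have "(x /\<^sub>R infnorm x) $ p = (x /\<^sub>R infnorm x) $ q"
      if "i \<in> {1..k} \<and> p \<in> W i \<and> q \<in> W i" for i p q
    proof -
      have "x $ p = x $ q" using xC[THEN conjunct1, THEN conjunct2] that by blast
      then show ?thesis by simp
    qed
    moreover have "(x /\<^sub>R infnorm x) $ p = 0" if "p \<notin> (\<Union>i\<in>{1..k}. W i)" for p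
    proof -
      have "x $ p = 0" using xC[THEN conjunct2] that by blast
      then show ?thesis by simp
    qed
    ultimately show ?thesis unfolding step_sphere_def by blast
  qed
  have "k \<le> m" if m: "odd_map_to (step_sphere k W) m" for m
  proof -
    have "odd_map_to (cross_sphere e l) m"
    proof (rule odd_map_to_compose[OF m])
      show "continuous_on (cross_sphere e l) (\<lambda>x. x /\<^sub>R infnorm x)"
      proof (intro continuous_intros ballI)
        fix x assume "x \<in> cross_sphere e l"
        then show "infnorm x \<noteq> 0" using oct unfolding cross_sphere_def infnorm_eq_0 by blast
      qed
      show "(\<lambda>x. x /\<^sub>R infnorm x) ` cross_sphere e l \<subseteq> step_sphere k W"
        using oct unfolding cross_sphere_def by blast
    qed (simp add: infnorm_neg)
    then have "l < m" by (rule borsuk_ulam_cross_sphere)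
    then show ?thesis by (simp add: l)
  qed
  then have "enat k \<le> genus (step_sphere k W)" by (simp add: genus_ge_iff)
  moreover have "step_sphere k W = uminus ` step_sphere k W"
  proof (intro equalityI subsetI)
    fix x assume "x \<in> step_sphere k W"
    then show "x \<in> uminus ` step_sphere k W"
      using uminus_step_sphere by (intro image_eqI[of x uminus "- x"]) simp_all
  qed (use uminus_step_sphere in blast)
  ultimately show ?thesis
    unfolding admissible_def using compact_step_sphere by (simp add: step_sphere_def subset_iff)
qed

lemma admissible_exists:
  assumes "1 \<le> k" "k \<le> CARD('v)"
  shows "admissible k \<noteq> ({} :: (real ^ 'v::finite) set set)"
proof -
  obtain W :: "nat \<Rightarrow> 'v set" where "disjoint_nonempty_family k W"
    using multi_cut_attained[OF assms(2)] .
  from step_sphere_admissible[OF this assms(1)] show ?thesis by blast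
qed

text \<open>Inside \<open>U\<close> superlevel sets are unions of classes, so each cuts at most
  \<open>c\<close> edges and the coarea formula applies. An edge with one end in \<open>U\<close>
  changes by at most 1, because \<open>x\<close> is \<open>0\<close> outside \<open>U\<close>; edges
  outside \<open>U\<close> contribute nothing.\<close>

lemma total_variation_step:
  assumes W: "disjoint_nonempty_family k W" and x: "x \<in> step_sphere k W"
  shows "total_variation E x \<le> MC E k W"
proof -
  define U where "U = (\<Union>i\<in>{1..k}. W i)"
  define c where "c = (MAX S\<in>Pow {1..k}. card (adj E \<inter> (\<Union>i\<in>S. W i) \<times> (\<Union>j\<in>{1..k} - S. W j)))"
  have inf: "infnorm x = 1" and const: "\<And>i p q. i \<in> {1..k} \<Longrightarrow> p \<in> W i \<Longrightarrow> q \<in> W i \<Longrightarrow> x $ p = x $ q"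
    and zero: "\<And>p. p \<notin> U \<Longrightarrow> x $ p = 0"
    using x unfolding step_sphere_def U_def by blast+
  have le: "\<bar>x $ i\<bar> \<le> 1" for i using component_le_infnorm_cart[of x i] inf by simp
  have "(\<Sum>(i, j)\<in>adj E. \<bar>x $ i - x $ j\<bar>) \<le>
      (\<Sum>p\<in>adj E. (if p \<in> U \<times> U then (case p of (i, j) \<Rightarrow> \<bar>x $ i - x $ j\<bar>) else 0) +
        (case p of (i, j) \<Rightarrow> of_bool ((i \<in> U) \<noteq> (j \<in> U))))"
  proof (intro sum_mono, clarify)
    fix i j
    show "\<bar>x $ i - x $ j\<bar> \<le> (if (i, j) \<in> U \<times> U then \<bar>x $ i - x $ j\<bar> else 0) + of_bool ((i \<in> U) \<noteq> (j \<in> U))"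
      using le[of i] le[of j] zero[of i] zero[of j] by (cases "i \<in> U"; cases "j \<in> U") simp_all
  qed
  \<comment> \<open>Every edge appears in both orientations, and the levels range over an interval
    of length 2: the bound becomes \<open>4 * c\<close> plus twice the edges leaving
    \<open>U\<close>, and halving yields \<open>MC\<close>.\<close>
  also have "\<dots> = (\<Sum>(i, j)\<in>adj E \<inter> U \<times> U. \<bar>x $ i - x $ j\<bar>) + 2 * card (adj E \<inter> U \<times> (- U))"
    unfolding sum.distrib sum_level_set[OF finite sym_adj] sum.inter_restrict[OF finite] ..
  also have "(\<Sum>(i, j)\<in>adj E \<inter> U \<times> U. \<bar>x $ i - x $ j\<bar>) \<le> 2 * real c * (1 - (- 1))"
  proof (rule sum_abs_diff_le)
    show "sym (adj E \<inter> U \<times> U)" using sym_adj[of E] by (auto simp: sym_def)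
    show "x $ i \<in> {- 1..1} \<and> x $ j \<in> {- 1..1}" for i j using le[of i] le[of j] by auto
    fix t
    \<comment> \<open>The classes above level \<open>t\<close>; as \<open>x\<close> is constant on a
      class, it lies above entirely or not at all.\<close>
    define S where "S = {i \<in> {1..k}. \<exists>p\<in>W i. t < x $ p}"
    have "adj E \<inter> U \<times> U \<inter> {i. t < x $ i} \<times> (- {i. t < x $ i}) \<subseteq>
        adj E \<inter> (\<Union>i\<in>S. W i) \<times> (\<Union>j\<in>{1..k} - S. W j)"
    proof (rule subrelI)
      fix p q assume "(p, q) \<in> adj E \<inter> U \<times> U \<inter> {i. t < x $ i} \<times> (- {i. t < x $ i})"
      then have pq: "(p, q) \<in> adj E" and p: "p \<in> U" "t < x $ p" and q: "q \<in> U" "\<not> t < x $ q"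
        by auto
      have "p \<in> (\<Union>i\<in>S. W i)" using p unfolding S_def U_def by blast
      moreover obtain j where j: "j \<in> {1..k}" "q \<in> W j" using q unfolding U_def by blast
      have "j \<notin> S"
      proof
        assume "j \<in> S"
        then obtain r where "r \<in> W j" "t < x $ r" unfolding S_def by blast
        with const[OF j(1) this(1) j(2)] q(2) show False by simp
      qed
      then have "q \<in> (\<Union>j\<in>{1..k} - S. W j)" using j by blast
      ultimately show "(p, q) \<in> adj E \<inter> (\<Union>i\<in>S. W i) \<times> (\<Union>j\<in>{1..k} - S. W j)"
        using pq by blast
    qed
    then have "card (adj E \<inter> U \<times> U \<inter> {i. t < x $ i} \<times> (- {i. t < x $ i})) \<le>
        card (adj E \<inter> (\<Union>i\<in>S. W i) \<times> (\<Union>j\<in>{1..k} - S. W j))"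
      by (intro card_mono) auto
    also have "\<dots> \<le> c"
      unfolding c_def by (intro Max_ge finite_imageI imageI) (auto simp: S_def)
    finally show "card (adj E \<inter> U \<times> U \<inter> {i. t < x $ i} \<times> (- {i. t < x $ i})) \<le> c" .
  qed auto
  finally show ?thesis
    unfolding total_variation_def MC_eq[OF W] c_def[symmetric] U_def[symmetric] by (simp add: Compl_eq_Diff_UNIV)
qed

lemma minmax_le_multi_cut:
  fixes E :: "'v::finite set set"
  assumes "simple_graph E" "E \<noteq> {}" "1 \<le> k" "k \<le> CARD('v)"
  shows "vol E * minmax_value E k \<le> multi_cut E k"
proof -
  obtain W where W: "disjoint_nonempty_family k (W :: nat \<Rightarrow> 'v set)" "multi_cut E k = MC E k W"
    using multi_cut_attained[OF assms(4)] .
  show ?thesis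
    unfolding W(2)
    by (rule minmax_le[OF assms(1,2) step_sphere_admissible[OF W(1) assms(3)] assms(3) total_variation_step[OF W(1)]])
qed

section \<open>Lower bounds for k = n and k = 2\<close>

lemma two_le_card:
  fixes E :: "'v::finite set set"
  assumes "simple_graph E" "E \<noteq> {}"
  shows "2 \<le> CARD('v)"
proof -
  obtain e where "e \<in> E" "card e = 2" using assms unfolding simple_graph_def by blast
  then show ?thesis using card_mono[of UNIV e] by simp
qed

text \<open>If \<open>p\<close> were missing, projecting along \<open>p\<close> to a coordinate hyperplane would have no zero on \<open>A\<close>.\<close>

lemma admissible_full:
  fixes A :: "(real ^ 'v::finite) set"
  assumes A: "A \<in> admissible CARD('v)" and p: "infnorm p = 1"
  shows "p \<in> A"
proof (rule ccontr)
  assume np: "p \<notin> A"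
  have sym: "- x \<in> A" if "x \<in> A" for x using A that unfolding admissible_def by blast
  then have np': "- p \<notin> A" using np by fastforce
  obtain i0 where i0: "\<bar>p $ i0\<bar> = 1" using infnorm_attained[of p] p by auto
  define n where "n = CARD('v) - 1"
  have "card (UNIV - {i0} :: 'v set) = n" by (simp add: n_def)
  then obtain g where g: "bij_betw g {0..<n} (UNIV - {i0})"
    using ex_bij_betw_nat_finite[OF finite, of "UNIV - {i0}"] by metis
  have "odd_map_to A n"
    unfolding odd_map_to_def
  proof (intro exI[of _ "\<lambda>x j. x $ g j - x $ i0 * (p $ g j / p $ i0)"] conjI ballI allI impI)
    fix x assume x: "x \<in> A"
    show "\<exists>j<n. x $ g j - x $ i0 * (p $ g j / p $ i0) \<noteq> 0"
    proof (rule ccontr)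
      assume neg: "\<not> ?thesis"
      \<comment> \<open>A joint zero makes \<open>x\<close> a multiple of \<open>p\<close>; equal
        norms leave only \<open>p\<close> and \<open>- p\<close>, both outside
        \<open>A\<close>.\<close>
      define c where "c = x $ i0 / p $ i0"
      have "x $ i = c * p $ i" for i
      proof (cases "i = i0")
        case True
        then show ?thesis using i0 by (auto simp: c_def)
      next
        case False
        then have "i \<in> g ` {0..<n}" using g by (auto simp: bij_betw_def)
        then obtain j where "j < n" "i = g j" by auto
        then show ?thesis using neg by (simp add: c_def)
      qed
      then have xc: "x = c *\<^sub>R p" by (simp add: vec_eq_iff)
      moreover have "infnorm x = 1" using A x by (auto simp: admissible_def)
      ultimately have "\<bar>c\<bar> = 1" using p by (simp add: infnorm_mul)
      then have "c = 1 \<or> c = - 1" by linarith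
      then have "x = p \<or> x = - p" using xc by auto
      then show False using x np np' by blast
    qed
  qed (use i0 in \<open>auto intro!: continuous_intros simp: algebra_simps\<close>)
  then have "CARD('v) \<le> n" using A by (auto simp: admissible_def genus_ge_iff)
  then show False using zero_less_card_finite[where 'a='v] unfolding n_def by linarith
qed

lemma total_variation_signs:
  fixes S :: "'v::finite set"
  defines "x \<equiv> \<chi> i. if i \<in> S then 1 else - 1"
  shows "infnorm x = 1" "total_variation E x = 2 * card (edges_between E S (UNIV - S))"
proof -
  have "\<bar>x $ i\<bar> = 1" for i by (simp add: x_def)
  then show "infnorm x = 1" using infnorm_attained[of x] by metis
  have "(\<Sum>(i, j)\<in>adj E. \<bar>x $ i - x $ j\<bar>) = (\<Sum>(i, j)\<in>adj E. 2 * of_bool ((i \<in> S) \<noteq> (j \<in> S)))"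
    by (intro sum.cong) (auto simp: x_def)
  also have "\<dots> = 2 * (\<Sum>(i, j)\<in>adj E. of_bool ((i \<in> S) \<noteq> (j \<in> S)))"
    unfolding sum_distrib_left by (intro sum.cong) auto
  also have "\<dots> = 2 * (2 * real (card (edges_between E S (UNIV - S))))"
    unfolding sum_level_set[OF finite sym_adj] by (simp add: card_edges_between Compl_eq_Diff_UNIV)
  finally show "total_variation E x = 2 * card (edges_between E S (UNIV - S))"
    by (simp add: total_variation_def)
qed

text \<open>
  The vector is a zero of the odd function that subtracts the norm of the negative part of \<open>x\<close>
  from the norm of its positive part.
\<close>

lemma admissible_two:
  fixes A :: "(real ^ 'v::finite) set"
  assumes A: "A \<in> admissible 2"
  obtains x p q where "x \<in> A" "x $ p = 1" "x $ q = - 1"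
proof -
  define h :: "real ^ 'v \<Rightarrow> real" where "h x = infnorm (\<chi> i. max (x $ i) 0) - infnorm (\<chi> i. max (- (x $ i)) 0)" for x
  have inf: "infnorm x = 1" if "x \<in> A" for x using A that by (auto simp: admissible_def)
  have "\<not> odd_map_to A 1" using A by (auto simp: admissible_def genus_ge_iff)
  moreover have "continuous_on A h"
    unfolding h_def by (intro continuous_intros)
  moreover have "h (- x) = - h x" for x by (simp add: h_def)
  ultimately have "\<exists>x\<in>A. h x = 0"
    unfolding odd_map_to_def by (auto dest!: spec[of _ "\<lambda>x j. h x"])
  then obtain x where x: "x \<in> A" "h x = 0" by blast
  obtain i where i: "\<bar>x $ i\<bar> = 1" using infnorm_attained[of x] inf[OF x(1)] by metis
  obtain p where p: "\<bar>(\<chi> i. max (x $ i) 0) $ p\<bar> = infnorm (\<chi> i. max (x $ i) 0)"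
    using infnorm_attained .
  obtain q where q: "\<bar>(\<chi> i. max (- (x $ i)) 0) $ q\<bar> = infnorm (\<chi> i. max (- (x $ i)) 0)"
    using infnorm_attained .
  \<comment> \<open>The norm of \<open>x\<close> is 1, so one of its two parts has norm 1, and
    \<open>h x = 0\<close> carries this to the other.\<close>
  have eq: "max (x $ p) 0 = max (- (x $ q)) 0"
    using x(2) p q by (simp add: h_def)
  have "max (x $ i) 0 \<le> max (x $ p) 0"
    using component_le_infnorm_cart[of "\<chi> i. max (x $ i) 0" i] p by simp
  moreover have "max (- (x $ i)) 0 \<le> max (- (x $ q)) 0"
    using component_le_infnorm_cart[of "\<chi> i. max (- (x $ i)) 0" i] q by simp
  ultimately have "1 \<le> x $ p" "x $ q \<le> - 1" using eq i by (auto simp: max_def abs_if split: if_splits)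
  moreover have "\<bar>x $ p\<bar> \<le> 1" "\<bar>x $ q\<bar> \<le> 1"
    using component_le_infnorm_cart[of x] inf[OF x(1)] by auto
  ultimately have "x $ p = 1" "x $ q = - 1" by auto
  with x(1) that show ?thesis by blast
qed

text \<open>Every superlevel set at a level in \<open>{- 1..<1}\<close> contains \<open>p\<close>
  but not \<open>q\<close>, so the coarea lower bound applies over an interval of length 2.\<close>

lemma total_variation_ge_cut:
  fixes x :: "real ^ 'v::finite"
  assumes x: "infnorm x = 1" "x $ p = 1" "x $ q = - 1"
    and cut: "\<And>S. S \<noteq> {} \<Longrightarrow> S \<subset> UNIV \<Longrightarrow> c \<le> card (edges_between E S (UNIV - S))"
  shows "2 * real c \<le> total_variation E x"
proof -
  have "2 * real c * (1 - (- 1)) \<le> (\<Sum>(i, j)\<in>adj E. \<bar>x $ i - x $ j\<bar>)"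
  proof (rule sum_abs_diff_ge[OF finite sym_adj])
    show "x $ i \<in> {- 1..1} \<and> x $ j \<in> {- 1..1}" for i j
      using component_le_infnorm_cart[of x i] component_le_infnorm_cart[of x j] x(1) by auto
    fix t :: real assume t: "t \<in> {- 1..<1}"
    have "p \<in> {i. t < x $ i}" "q \<notin> {i. t < x $ i}" using t x by auto
    then have "c \<le> card (edges_between E {i. t < x $ i} (UNIV - {i. t < x $ i}))"
      by (intro cut) auto
    then show "c \<le> card (adj E \<inter> {i. t < x $ i} \<times> (- {i. t < x $ i}))"
      by (simp add: card_edges_between Compl_eq_Diff_UNIV)
  qed simp
  then show ?thesis by (simp add: total_variation_def)
qed

theorem theorem4p13:
  fixes E :: "'v::finite set set"
  assumes "simple_graph E" and "E \<noteq> {}"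
  shows "(\<forall>k\<in>{1..CARD('v)}. \<forall>m.
            (\<exists>x. eigenpair_M E (minmax_value E k) x \<and>
                 (card (nodal_domains E x) = m \<or> card (null_domains E x) = m)) \<longrightarrow>
            real (multi_cut E m) \<le> real (vol E) * minmax_value E k \<and>
            real (vol E) * minmax_value E k \<le> real (multi_cut E k))
       \<and> real (vol E) * minmax_value E CARD('v) = real (multi_cut E CARD('v))
       \<and> multi_cut E CARD('v) =
           2 * (MAX S\<in>{S. S \<noteq> {} \<and> S \<subset> UNIV}. card (edges_between E S (UNIV - S)))
       \<and> real (vol E) * minmax_value E 2 = real (multi_cut E 2)
       \<and> multi_cut E 2 =
           2 * (MIN S\<in>{S. S \<noteq> {} \<and> S \<subset> UNIV}. card (edges_between E S (UNIV - S)))"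
proof -
  define cut where "cut S = card (edges_between E S (UNIV - S))" for S
  define Prop where "Prop = {S :: 'v set. S \<noteq> {} \<and> S \<subset> UNIV}"
  have n2: "2 \<le> CARD('v)" using two_le_card[OF assms] .
  \<comment> \<open>\<open>Max\<close> and \<open>Min\<close> below need a nonempty set: a singleton
    is a proper subset because an edge gives two vertices.\<close>
  have ne: "cut ` Prop \<noteq> {}"
  proof -
    obtain a :: 'v where True by blast
    have "{a} \<noteq> UNIV"
    proof
      assume "{a} = UNIV"
      then have "CARD('v) = card {a}" by simp
      then show False using n2 by simp
    qed
    then have "{a} \<in> Prop" by (auto simp: Prop_def)
    then show ?thesis by blast
  qed
  have upper: "real (vol E) * minmax_value E k \<le> real (multi_cut E k)" if "k \<in> {1..CARD('v)}" for k
    using that by (intro minmax_le_multi_cut assms) auto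
  have cut_triv: "edges_between E {} B = {}" "edges_between E B {} = {}" for B
    by (auto simp: edges_between_def)

  \<comment> \<open>The partition into singletons leaves no vertex uncovered, and its bipartitions
    are the cuts of all vertex sets; the trivial ones cut no edge.\<close>
  have n: "multi_cut E CARD('v) \<le> 2 * Max (cut ` Prop)"
  proof -
    define N :: "'v set set" where "N = range (\<lambda>i. {i})"
    have U: "\<Union>N = UNIV" by (auto simp: N_def)
    have "multi_cut E (card N) \<le> 2 * Max (cut ` Prop) + card (adj E \<inter> \<Union>N \<times> (UNIV - \<Union>N))"
    proof (rule multi_cut_le)
      show "disjoint N" "{} \<notin> N" by (auto simp: N_def disjoint_def)
      fix X assume X: "X \<subseteq> N"
      have "\<Union>(N - X) = UNIV - \<Union>X" using X by (auto simp: N_def)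
      moreover have "cut (\<Union>X) \<le> Max (cut ` Prop)"
      proof (cases "\<Union>X \<in> Prop")
        case False
        then have "\<Union>X = {} \<or> \<Union>X = UNIV" unfolding Prop_def by blast
        then have "cut (\<Union>X) = 0"
          by (elim disjE) (simp_all only: cut_def cut_triv Diff_cancel card.empty)
        then show ?thesis by simp
      qed simp
      ultimately show "card (edges_between E (\<Union>X) (\<Union>(N - X))) \<le> Max (cut ` Prop)"
        by (simp add: cut_def)
    qed
    moreover have "card N = CARD('v)" by (simp add: N_def card_image)
    ultimately show ?thesis unfolding U by simp
  qed
  have "Max (cut ` Prop) \<in> cut ` Prop" using ne by (intro Max_in) auto
  then obtain S where S: "Max (cut ` Prop) = cut S" by blast
  \<comment> \<open>Every admissible set contains the sign vector of a maximum cut \<open>S\<close>,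
    which closes the circle of inequalities.\<close>
  have "real (2 * Max (cut ` Prop)) \<le> real (vol E) * minmax_value E CARD('v)"
  proof (rule minmax_ge[OF assms])
    show "admissible CARD('v) \<noteq> ({} :: (real ^ 'v) set set)" using n2 by (intro admissible_exists) auto
    fix A :: "(real ^ 'v) set" assume "A \<in> admissible CARD('v)"
    from admissible_full[OF this total_variation_signs(1)[of S]]
    show "\<exists>x\<in>A. real (2 * Max (cut ` Prop)) \<le> total_variation E x"
      unfolding S by (rule bexI[rotated]) (simp add: total_variation_signs(2) cut_def)
  qed
  moreover have "real (vol E) * minmax_value E CARD('v) \<le> real (multi_cut E CARD('v))"
    using n2 by (intro upper) simp
  ultimately
  have res_n: "real (vol E) * minmax_value E CARD('v) = real (multi_cut E CARD('v))"
    "multi_cut E CARD('v) = 2 * Max (cut ` Prop)"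
    using n
    by linarith+

  \<comment> \<open>A minimum cut \<open>S\<close> and its complement form a family of two classes,
    whose only nontrivial bipartition cuts \<open>cut S\<close> edges.\<close>
  have two: "multi_cut E 2 \<le> 2 * Min (cut ` Prop)"
  proof -
    have "Min (cut ` Prop) \<in> cut ` Prop" using ne by (intro Min_in) auto
    then obtain S where S: "Min (cut ` Prop) = cut S" "S \<noteq> {}" "S \<noteq> UNIV" unfolding Prop_def by blast
    define N where "N = {S, - S}"
    have SN: "S \<noteq> - S" using S(2) by auto
    have U: "\<Union>N = UNIV" by (auto simp: N_def)
    have "multi_cut E (card N) \<le> 2 * cut S + card (adj E \<inter> \<Union>N \<times> (UNIV - \<Union>N))"
    proof (rule multi_cut_le)
      show "disjoint N" "{} \<notin> N" using S(2,3) by (auto simp: N_def disjoint_def)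
      fix X assume "X \<subseteq> N"
      then have "X = {} \<or> X = {S} \<or> X = {- S} \<or> X = {S, - S}" unfolding N_def by blast
      then have "\<Union>X = {} \<or> \<Union>(N - X) = {} \<or> \<Union>X = S \<and> \<Union>(N - X) = - S \<or> \<Union>X = - S \<and> \<Union>(N - X) = S"
        using SN by (auto simp: N_def)
      then show "card (edges_between E (\<Union>X) (\<Union>(N - X))) \<le> cut S"
        using edges_between_commute[of E S "- S"]
        by (elim disjE conjE) (simp_all only: cut_triv cut_def Compl_eq_Diff_UNIV card.empty le0 order_refl)
    qed
    moreover have "card N = 2" using SN by (simp add: N_def)
    ultimately show ?thesis unfolding U S(1) by simp
  qed
  have "real (2 * Min (cut ` Prop)) \<le> real (vol E) * minmax_value E 2"
  proof (rule minmax_ge[OF assms])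
    show "admissible 2 \<noteq> ({} :: (real ^ 'v) set set)" using n2 by (intro admissible_exists) auto
    fix A :: "(real ^ 'v) set" assume A: "A \<in> admissible 2"
    obtain x p q where x: "x \<in> A" "x $ p = 1" "x $ q = - 1" using admissible_two[OF A] .
    have "infnorm x = 1" using A x(1) by (auto simp: admissible_def)
    then have "2 * real (Min (cut ` Prop)) \<le> total_variation E x"
      by (rule total_variation_ge_cut[OF _ x(2,3)]) (auto simp: cut_def Prop_def intro!: Min_le)
    then show "\<exists>x\<in>A. real (2 * Min (cut ` Prop)) \<le> total_variation E x"
      using x(1) by (intro bexI[of _ x]) simp_all
  qed
  moreover have "real (vol E) * minmax_value E 2 \<le> real (multi_cut E 2)"
    using n2 by (intro upper) simp
  ultimately
  have res_2: "real (vol E) * minmax_value E 2 = real (multi_cut E 2)"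
    "multi_cut E 2 = 2 * Min (cut ` Prop)"
    using two
    by linarith+

  have "real (multi_cut E m) \<le> real (vol E) * minmax_value E k"
    if "eigenpair_M E (minmax_value E k) x" "card (nodal_domains E x) = m \<or> card (null_domains E x) = m" for k m x
    using multi_cut_le_eigenvalue[OF that] by (simp add: mult.commute)
  then have "\<forall>k\<in>{1..CARD('v)}. \<forall>m.
      (\<exists>x. eigenpair_M E (minmax_value E k) x \<and>
           (card (nodal_domains E x) = m \<or> card (null_domains E x) = m)) \<longrightarrow>
      real (multi_cut E m) \<le> real (vol E) * minmax_value E k \<and>
      real (vol E) * minmax_value E k \<le> real (multi_cut E k)"
    using upper by blast
  from conjI[OF this conjI[OF res_n(1) conjI[OF res_n(2) conjI[OF res_2]]]] show ?thesis
    unfolding cut_def[abs_def] Prop_def .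
qed

end
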